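(* Let $w\in W_C$. If there exist $x\in\mathfrak g_C$ and a type C Hessenberg space $H_C\subseteq\mathfrak g_C$ such that $\mathcal B_C(x,H_C)=X^C_{w^{-1}}$, then $w$, viewed as a permutation in $S_{2n}$, avoids the pattern $[4231]$. (Equivalently, since $[4231]$ is its own inverse: if $\mathcal B_C(x,H_C)=X^C_w$ then $w$ avoids $[4231]$.)
   Context: Let $J$ be the $n\times n$ antidiagonal matrix of $1$'s, $E=\begin{bmatrix}0&J\\-J&0\end{bmatrix}$, and $\sigma(A)=E(A^{\mathsf{tr}})^{-1}E^{-1}$ on $SL_{2n}(\mathbb C)$ with differential $\sigma(x)=Ex^{\mathsf{tr}}E$. $G_C=SL_{2n}(\mathbb C)^\sigma\cong Sp_{2n}(\mathbb C)$, $\mathfrak g_C=\mathfrak{sl}_{2n}(\mathbb C)^\sigma\cong\mathfrak{sp}_{2n}(\mathbb C)$, $B$ the upper triangular matrices in $SL_{2n}(\mathbb C)$, $B_C=B^\sigma$ (a Borel subgroup of $G_C$) with Lie algebra $\mathfrak b_C$. The Weyl group of $G_C$ is identified with $W_C=\{w\in S_{2n}: w(2n+1-i)=2n+1-w(i)\ \forall i\}$; $\dot w\in N_{G_C}(T^\sigma)$ is a representative ($T$ the diagonal torus). $X^C_w$ is the closure of $B_C\dot wB_C/B_C$ in $G_C/B_C$. A type C Hessenberg space is a subspace $H_C\subseteq\mathfrak g_C$ with $[\mathfrak b_C,H_C]\subseteq H_C$; $\mathcal B_C(x,H_C)=\{gB_C: g^{-1}xg\in H_C\}$. A permutation $w\in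 S_N$ contains the pattern $v\in S_m$ if there are indices $i_1<\dots<i_m$ with $w(i_a)<w(i_b)\iff v(a)<v(b)$ for all $a,b$; otherwise it avoids $v$. *)

theory Defs
  imports "HOL-Analysis.Analysis"
begin

text \<open>Square matrices of size N are modelled as functions nat => nat => complex that
vanish outside the index range {0..<N} x {0..<N} (indices are 0-based).
The type nat => nat => complex carries the product topology, whose restriction
to such matrices is the usual Euclidean topology on N x N complex matrices.\<close>

type_synonym cmat = "nat \<Rightarrow> nat \<Rightarrow> complex"

definition is_mat :: "nat \<Rightarrow> cmat \<Rightarrow> bool" where
  "is_mat N A \<longleftrightarrow> (\<forall>i j. (N \<le> i \<or> N \<le> j) \<longrightarrow> A i j = 0)"

definition mmul :: "nat \<Rightarrow> cmat \<Rightarrow> cmat \<Rightarrow> cmat" where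
  "mmul N A B = (\<lambda>i j. if i < N \<and> j < N then (\<Sum>k<N. A i k * B k j) else 0)"

definition madd :: "cmat \<Rightarrow> cmat \<Rightarrow> cmat" where
  "madd A B = (\<lambda>i j. A i j + B i j)"

definition msub :: "cmat \<Rightarrow> cmat \<Rightarrow> cmat" where
  "msub A B = (\<lambda>i j. A i j - B i j)"

definition msmult :: "complex \<Rightarrow> cmat \<Rightarrow> cmat" where
  "msmult c A = (\<lambda>i j. c * A i j)"

definition zmat :: cmat where
  "zmat = (\<lambda>i j. 0)"

definition idm :: "nat \<Rightarrow> cmat" where
  "idm N = (\<lambda>i j. if i < N \<and> j < N \<and> i = j then 1 else 0)"

definition mtr :: "cmat \<Rightarrow> cmat" where
  "mtr A = (\<lambda>i j. A j i)"

definition mdet :: "nat \<Rightarrow> cmat \<Rightarrow> complex" where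
  "mdet N A = (\<Sum>p | p permutes {..<N}. of_int (sign p) * (\<Prod>i<N. A i (p i)))"

definition mtrace :: "nat \<Rightarrow> cmat \<Rightarrow> complex" where
  "mtrace N A = (\<Sum>i<N. A i i)"

definition minv :: "nat \<Rightarrow> cmat \<Rightarrow> cmat" where
  "minv N A = (THE B. is_mat N B \<and> mmul N A B = idm N \<and> mmul N B A = idm N)"

definition SL :: "nat \<Rightarrow> cmat set" where
  "SL N = {A. is_mat N A \<and> mdet N A = 1}"

definition sl :: "nat \<Rightarrow> cmat set" where
  "sl N = {A. is_mat N A \<and> mtrace N A = 0}"

definition Jmat :: "nat \<Rightarrow> cmat" where
  "Jmat n = (\<lambda>i j. if i < n \<and> j < n \<and> i + j = n - 1 then 1 else 0)"

definition Emat :: "nat \<Rightarrow> cmat" where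
  "Emat n = (\<lambda>i j.
      if i < n \<and> n \<le> j \<and> j < 2*n then Jmat n i (j - n)
      else if n \<le> i \<and> i < 2*n \<and> j < n then - Jmat n (i - n) j
      else 0)"

text \<open>The involution sigma(A) = E (A^tr)^(-1) E^(-1) on SL_2n and its differential
sigma(x) = E x^tr E.\<close>
definition sigmaG :: "nat \<Rightarrow> cmat \<Rightarrow> cmat" where
  "sigmaG n A = mmul (2*n) (mmul (2*n) (Emat n) (minv (2*n) (mtr A))) (minv (2*n) (Emat n))"

definition sigmaL :: "nat \<Rightarrow> cmat \<Rightarrow> cmat" where
  "sigmaL n x = mmul (2*n) (mmul (2*n) (Emat n) (mtr x)) (Emat n)"

definition GC :: "nat \<Rightarrow> cmat set" where
  "GC n = {A \<in> SL (2*n). sigmaG n A = A}"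

definition gC :: "nat \<Rightarrow> cmat set" where
  "gC n = {x \<in> sl (2*n). sigmaL n x = x}"

definition upper :: "cmat \<Rightarrow> bool" where
  "upper A \<longleftrightarrow> (\<forall>i j. j < i \<longrightarrow> A i j = 0)"

definition Bor :: "nat \<Rightarrow> cmat set" where
  "Bor n = {A \<in> SL (2*n). upper A}"

definition BC :: "nat \<Rightarrow> cmat set" where
  "BC n = {A \<in> Bor n. sigmaG n A = A}"

definition bC :: "nat \<Rightarrow> cmat set" where
  "bC n = {x \<in> gC n. upper x}"

definition lcoset :: "nat \<Rightarrow> cmat \<Rightarrow> cmat set" where
  "lcoset n g = {mmul (2*n) g b | b. b \<in> BC n}"

definition flagC :: "nat \<Rightarrow> cmat set set" where
  "flagC n = lcoset n ` GC n"

definition flag_top :: "nat \<Rightarrow> cmat set topology" where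
  "flag_top n = topology (\<lambda>S. S \<subseteq> flagC n \<and>
      openin (top_of_set (GC n)) {g \<in> GC n. lcoset n g \<in> S})"

text \<open>Weyl group W_C (0-based version of w(2n+1-i) = 2n+1-w(i)).\<close>
definition WC :: "nat \<Rightarrow> (nat \<Rightarrow> nat) set" where
  "WC n = {w. w permutes {..<2*n} \<and> (\<forall>i<2*n. w (2*n - 1 - i) = 2*n - 1 - w i)}"

text \<open>Representatives of w in N_{G_C}(T^sigma): elements of G_C that are monomial
with nonzero entries exactly at the positions (w j, j).\<close>
definition reps :: "nat \<Rightarrow> (nat \<Rightarrow> nat) \<Rightarrow> cmat set" where
  "reps n w = {d \<in> GC n. \<forall>i<2*n. \<forall>j<2*n. d i j \<noteq> 0 \<longleftrightarrow> i = w j}"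

text \<open>Schubert cell B_C w B_C / B_C (independent of the representative) and the
Schubert variety X^C_w, its closure in G_C/B_C.\<close>
definition schubert_cell :: "nat \<Rightarrow> (nat \<Rightarrow> nat) \<Rightarrow> cmat set set" where
  "schubert_cell n w = {lcoset n (mmul (2*n) b d) | b d. b \<in> BC n \<and> d \<in> reps n w}"

definition schubert_C :: "nat \<Rightarrow> (nat \<Rightarrow> nat) \<Rightarrow> cmat set set" where
  "schubert_C n w = flag_top n closure_of schubert_cell n w"

definition bracket :: "nat \<Rightarrow> cmat \<Rightarrow> cmat \<Rightarrow> cmat" where
  "bracket N x y = msub (mmul N x y) (mmul N y x)"

definition hessenberg_C :: "nat \<Rightarrow> cmat set \<Rightarrow> bool" where
  "hessenberg_C n H \<longleftrightarrow> H \<subseteq> gC n \<and> zmat \<in> H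
     \<and> (\<forall>x\<in>H. \<forall>y\<in>H. madd x y \<in> H) \<and> (\<forall>c. \<forall>x\<in>H. msmult c x \<in> H)
     \<and> (\<forall>y\<in>bC n. \<forall>h\<in>H. bracket (2*n) y h \<in> H)"

definition hess_var :: "nat \<Rightarrow> cmat \<Rightarrow> cmat set \<Rightarrow> cmat set set" where
  "hess_var n x H = {lcoset n g | g. g \<in> GC n \<and> mmul (2*n) (mmul (2*n) (minv (2*n) g) x) g \<in> H}"

definition contains_pattern :: "nat \<Rightarrow> (nat \<Rightarrow> nat) \<Rightarrow> nat list \<Rightarrow> bool" where
  "contains_pattern N w v \<longleftrightarrow> (\<exists>idx. strict_mono_on {..<length v} idx
      \<and> (\<forall>a<length v. idx a < N)
      \<and> (\<forall>a<length v. \<forall>b<length v. w (idx a) < w (idx b) \<longleftrightarrow> v ! a < v ! b))"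

definition avoids :: "nat \<Rightarrow> (nat \<Rightarrow> nat) \<Rightarrow> nat list \<Rightarrow> bool" where
  "avoids N w v \<longleftrightarrow> \<not> contains_pattern N w v"

end

theory Submission
  imports Defs "Jordan_Normal_Form.Determinant"
begin

text \<open>
  Let \<open>v = w\<^sup>-\<^sup>1\<close>, suppose that \<open>X\<^sub>v = \<B>(x, H)\<close>, and let \<open>p1 < p2 < p3 < p4\<close> be positions at which
  \<open>v\<close> has the pattern 4231 (a self-inverse pattern). Let \<open>u\<close> be \<open>v\<close> with the values at \<open>p2\<close>, \<open>p3\<close>, and
  at their mirror images, exchanged. Then \<open>u\<close> lies above \<open>v\<close> in the Bruhat order, so a minor that vanishes
  on \<open>X\<^sub>v\<close> separates the fixed point \<open>u\<close> from \<open>X\<^sub>v\<close>. On the other hand \<open>u\<close> lies in \<open>\<B>(x, H)\<close>.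

  Since \<open>X\<^sub>v\<close> is stable under the Borel subgroup, \<open>x\<close> may be replaced by the span \<open>K\<close> of its orbit,
  and \<open>K\<close> and \<open>H\<close> both decompose into a diagonal part and root lines, the root lines being closed
  under raising the row index and the column index of a matrix unit. For a root line of \<open>K\<close> the
  condition at \<open>u\<close> follows from the condition at \<open>v\<close>, because the pattern allows one to trade any
  pair of positions \<open>(i, j)\<close> for \<open>(i', j')\<close> with \<open>i \<le> i'\<close>, \<open>j' \<le> j\<close>, \<open>v i' \<le> u i\<close> and \<open>u j \<le> v j'\<close>.
  For a diagonal \<open>t\<close> in \<open>K\<close>, the conjugates of \<open>t\<close> by the elements below \<open>v\<close>
  are in \<open>H\<close>, and their differences generate the coroot by which the conjugates of \<open>t\<close> by \<open>u\<close> and by \<open>v\<close> differ.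
\<close>

unbundle no m_inv_syntax

subsection \<open>Determinants and inverses\<close>

text \<open>Bridge to matrices that carry their dimension, through which multiplicativity of
  determinants, triangular determinants and adjugates are transferred.\<close>

definition to_mat :: "nat \<Rightarrow> cmat \<Rightarrow> complex mat" where
  "to_mat N A = mat N N (\<lambda>(i, j). A i j)"

lemma to_mat_carrier [simp]: "to_mat N A \<in> carrier_mat N N"
  by (simp add: to_mat_def)

lemma to_mat_index [simp]: "i < N \<Longrightarrow> j < N \<Longrightarrow> to_mat N A $$ (i, j) = A i j"
  by (simp add: to_mat_def)

lemma mdet_eq_det: "mdet N A = det (to_mat N A)"
  unfolding mdet_def det_def'[OF to_mat_carrier]
  by (intro sum.cong prod.cong refl arg_cong2[of _ _ _ _ "(*)"])
     (auto simp: atLeast0LessThan sign_def permutes_in_image intro!: to_mat_index[symmetric])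

lemma to_mat_mmul: "to_mat N (mmul N A B) = to_mat N A * to_mat N B"
  by (rule eq_matI) (auto simp: to_mat_def mmul_def scalar_prod_def atLeast0LessThan)

lemma mdet_mmul: "mdet N (mmul N A B) = mdet N A * mdet N B"
  by (simp add: mdet_eq_det to_mat_mmul det_mult[OF to_mat_carrier to_mat_carrier])

lemma mdet_cong: "(\<And>i j. i < N \<Longrightarrow> j < N \<Longrightarrow> A i j = B i j) \<Longrightarrow> mdet N A = mdet N B"
  by (auto simp: mdet_eq_det to_mat_def intro!: arg_cong[of _ _ det] eq_matI)

lemma mdet_upper:
  assumes "\<And>i j. j < i \<Longrightarrow> i < N \<Longrightarrow> A i j = 0"
  shows "mdet N A = (\<Prod>i<N. A i i)"
proof -
  have "upper_triangular (to_mat N A)"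
    using assms by (auto simp: to_mat_def)
  then show ?thesis
    by (simp add: mdet_eq_det det_upper_triangular[OF _ to_mat_carrier] prod_list_diag_prod
        atLeast0LessThan) (simp add: to_mat_def)
qed

lemma mdet_lower:
  assumes "\<And>i j. i < j \<Longrightarrow> j < N \<Longrightarrow> A i j = 0"
  shows "mdet N A = (\<Prod>i<N. A i i)"
proof -
  have "mdet N A = prod_list (diag_mat (to_mat N A))"
    unfolding mdet_eq_det by (rule det_lower_triangular[OF _ to_mat_carrier]) (use assms in auto)
  then show ?thesis
    by (simp add: prod_list_diag_prod atLeast0LessThan) (simp add: to_mat_def)
qed

text \<open>A product through fewer than \<open>k\<close> indices has rank below \<open>k\<close>:
  padding with zeros turns the sum over \<open>M\<close> into a product of two \<open>k\<close> by
  \<open>k\<close> matrices, one of them singular. This makes minors vanish on Schubert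
  cells.\<close>

lemma mdet_low_rank:
  assumes "finite M" "card M < k"
  shows "mdet k (\<lambda>a b. \<Sum>m\<in>M. X a m * Y m b) = 0"
proof -
  obtain e where e: "bij_betw e {..<card M} M"
    using ex_bij_betw_nat_finite[OF assms(1)] by (auto simp: atLeast0LessThan)
  define X' :: cmat where "X' = (\<lambda>a c. if c < card M then X a (e c) else 0)"
  define Y' :: cmat where "Y' = (\<lambda>c b. if c < card M then Y (e c) b else 0)"
  have "(\<Sum>m\<in>M. X a m * Y m b) = (\<Sum>c<k. X' a c * Y' c b)" for a b
  proof -
    have "(\<Sum>m\<in>M. X a m * Y m b) = (\<Sum>c<card M. X a (e c) * Y (e c) b)"
      by (rule sum.reindex_bij_betw[OF e, symmetric])
    also have "\<dots> = (\<Sum>c<k. X' a c * Y' c b)"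
      using assms(2) by (intro sum.mono_neutral_cong_left) (auto simp: X'_def Y'_def)
    finally show ?thesis .
  qed
  then have "mdet k (\<lambda>a b. \<Sum>m\<in>M. X a m * Y m b) = mdet k (mmul k X' Y')"
    by (intro mdet_cong) (simp add: mmul_def)
  also have "\<dots> = mdet k X' * mdet k Y'"
    by (rule mdet_mmul)
  \<comment> \<open>Row \<open>card M\<close> of \<open>Y'\<close> is zero, and every term of the
    Leibniz sum takes a factor from it.\<close>
  also have "mdet k Y' = 0"
    unfolding mdet_def
    by (intro sum.neutral ballI mult_eq_0_iff[THEN iffD2] disjI2 prod_zero)
       (use assms(2) in \<open>auto simp: Y'_def intro!: bexI[of _ "card M"]\<close>)
  finally show ?thesis by simp
qed

section \<open>Matrix algebra and two-sided inverses\<close>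

lemma is_mat_mmul [simp]: "is_mat N (mmul N A B)"
  by (auto simp: is_mat_def mmul_def)

lemma is_mat_idm [simp]: "is_mat N (idm N)"
  by (auto simp: is_mat_def idm_def)

lemma mmul_assoc: "mmul N (mmul N A B) C = mmul N A (mmul N B C)"
proof (intro ext)
  fix i j
  have "(\<Sum>k<N. (\<Sum>l<N. A i l * B l k) * C k j) = (\<Sum>l<N. A i l * (\<Sum>k<N. B l k * C k j))"
    by (simp add: sum_distrib_left sum_distrib_right mult.assoc) (rule sum.swap)
  then show "mmul N (mmul N A B) C i j = mmul N A (mmul N B C) i j"
    by (simp add: mmul_def)
qed

lemma mmul_idm_left [simp]: "is_mat N A \<Longrightarrow> mmul N (idm N) A = A"
  by (intro ext) (auto simp: mmul_def idm_def is_mat_def if_distrib[of "\<lambda>x. x * _"]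
      sum.delta sum.delta' cong: if_cong)

lemma mmul_idm_right [simp]: "is_mat N A \<Longrightarrow> mmul N A (idm N) = A"
  by (intro ext) (auto simp: mmul_def idm_def is_mat_def if_distrib[of "\<lambda>x. _ * x"]
      sum.delta sum.delta' cong: if_cong)

lemma minv_eqI:
  assumes "is_mat N B" "mmul N A B = idm N" "mmul N B A = idm N"
  shows "minv N A = B"
  unfolding minv_def
proof (rule the_equality)
  fix C assume C: "is_mat N C \<and> mmul N A C = idm N \<and> mmul N C A = idm N"
  have "C = mmul N C (mmul N A B)"
    using C assms by simp
  also have "\<dots> = mmul N (mmul N C A) B"
    by (simp only: mmul_assoc)
  also have "\<dots> = B"
    using C assms by simp
  finally show "C = B" .
qed (use assms in auto)

lemma to_mat_inject: "is_mat N A \<Longrightarrow> is_mat N B \<Longrightarrow> to_mat N A = to_mat N B \<Longrightarrow> A = B"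
proof (intro ext)
  fix i j assume "is_mat N A" "is_mat N B" "to_mat N A = to_mat N B"
  then show "A i j = B i j"
    by (cases "i < N \<and> j < N") (auto simp: is_mat_def dest: arg_cong[of _ _ "\<lambda>M. M $$ (i, j)"])
qed

lemma to_mat_idm: "to_mat N (idm N) = 1\<^sub>m N"
  by (rule eq_matI) (auto simp: to_mat_def idm_def)

lemma inverse_exists:
  assumes "is_mat N A" "mdet N A = 1"
  obtains B where "is_mat N B" "mmul N A B = idm N" "mmul N B A = idm N"
proof -
  let ?M = "to_mat N A"
  define B :: cmat where "B = (\<lambda>i j. if i < N \<and> j < N then adj_mat ?M $$ (i, j) else 0)"
  have toB: "to_mat N B = adj_mat ?M"
    using adj_mat(1)[OF to_mat_carrier, of N A] by (intro eq_matI) (auto simp: to_mat_def B_def)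
  have "det ?M = 1"
    using assms by (simp add: mdet_eq_det)
  then have "?M * adj_mat ?M = 1\<^sub>m N" "adj_mat ?M * ?M = 1\<^sub>m N"
    using adj_mat(2,3)[OF to_mat_carrier, of N A] by auto
  then have "mmul N A B = idm N" "mmul N B A = idm N"
    by (auto intro!: to_mat_inject[where N = N] simp: to_mat_mmul toB to_mat_idm)
  moreover have "is_mat N B"
    by (auto simp: is_mat_def B_def)
  ultimately show ?thesis
    using that by blast
qed

lemma mmul_madd_left: "mmul N (madd A B) C = madd (mmul N A C) (mmul N B C)"
  by (intro ext) (simp add: mmul_def madd_def distrib_right sum.distrib)

lemma mmul_madd_right: "mmul N A (madd B C) = madd (mmul N A B) (mmul N A C)"
  by (intro ext) (simp add: mmul_def madd_def distrib_left sum.distrib)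

lemma mmul_msmult_left: "mmul N (msmult c A) B = msmult c (mmul N A B)"
  by (intro ext) (simp add: mmul_def msmult_def sum_distrib_left mult.assoc)

lemma mmul_msmult_right: "mmul N A (msmult c B) = msmult c (mmul N A B)"
  by (intro ext) (simp add: mmul_def msmult_def sum_distrib_left mult.left_commute)

subsection \<open>The symplectic group and its Lie algebra in coordinates\<close>

locale symplectic =
  fixes n :: nat
begin

abbreviation N :: nat where "N \<equiv> 2 * n"

definition mir :: "nat \<Rightarrow> nat" where
  "mir i = N - Suc i"

text \<open>The sign in row \<open>i\<close> of \<open>E\<close>, whose only nonzero entry in that
  row stands in column \<open>mir i\<close>.\<close>

definition eps :: "nat \<Rightarrow> complex" where
  "eps i = (if i < n then 1 else -1)"

lemma mir_less [simp]: "i < N \<Longrightarrow> mir i < N"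
  by (auto simp: mir_def)

lemma mir_mir [simp]: "i < N \<Longrightarrow> mir (mir i) = i"
  by (auto simp: mir_def)

lemma mir_eq_iff [simp]: "i < N \<Longrightarrow> j < N \<Longrightarrow> mir i = mir j \<longleftrightarrow> i = j"
  by (auto simp: mir_def)

lemma mir_neq [simp]: "i < N \<Longrightarrow> mir i \<noteq> i" "i < N \<Longrightarrow> i \<noteq> mir i"
  unfolding mir_def by presburger+

lemma mir_less_iff [simp]: "i < N \<Longrightarrow> j < N \<Longrightarrow> mir i < mir j \<longleftrightarrow> j < i"
  by (auto simp: mir_def)

lemma mir_le_iff [simp]: "i < N \<Longrightarrow> j < N \<Longrightarrow> mir i \<le> mir j \<longleftrightarrow> j \<le> i"
  by (auto simp: mir_def)

lemma mir_swap: "i < N \<Longrightarrow> j < N \<Longrightarrow> mir i = j \<longleftrightarrow> i = mir j"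
  by (auto simp: mir_def)

lemma eps_mir [simp]: "i < N \<Longrightarrow> eps (mir i) = - eps i"
  by (auto simp: mir_def eps_def)

lemma eps_square [simp]: "eps i * eps i = 1" "eps i * (eps i * c) = c"
  by (auto simp: eps_def)

lemma eps_nonzero [simp]: "eps i \<noteq> 0"
  by (auto simp: eps_def)

lemma sum_mir: "(\<Sum>k<N. g (mir k)) = (\<Sum>k<N. g k)"
  unfolding mir_def by (rule sum.nat_diff_reindex)

text \<open>This is \<open>E^-1 A^tr E\<close>, the adjoint for the symplectic form. It is a linear
  anti-automorphism that gives the inverse on \<open>GC\<close> and the negative of
  \<open>sigmaL\<close> on matrices.\<close>

definition ginv :: "cmat \<Rightarrow> cmat" where
  "ginv A = (\<lambda>i j. if i < N \<and> j < N then eps i * eps j * A (mir j) (mir i) else 0)"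

lemma is_mat_ginv [simp]: "is_mat N (ginv A)"
  by (auto simp: is_mat_def ginv_def)

lemma ginv_ginv [simp]: "is_mat N A \<Longrightarrow> ginv (ginv A) = A"
  by (intro ext) (auto simp: ginv_def is_mat_def)

lemma ginv_idm [simp]: "ginv (idm N) = idm N"
  by (intro ext) (auto simp: ginv_def idm_def)

lemma ginv_mmul: "ginv (mmul N A B) = mmul N (ginv B) (ginv A)"
proof (intro ext)
  fix i j
  show "ginv (mmul N A B) i j = mmul N (ginv B) (ginv A) i j"
  proof (cases "i < N \<and> j < N")
    case True
    have "mmul N (ginv B) (ginv A) i j
        = (\<Sum>k<N. eps i * eps j * (A (mir j) (mir k) * B (mir k) (mir i)))"
      using True by (auto simp: mmul_def ginv_def intro!: sum.cong)
    also have "\<dots> = (\<Sum>k<N. eps i * eps j * (A (mir j) k * B k (mir i)))"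
      by (rule sum_mir)
    finally show ?thesis
      using True by (simp add: ginv_def mmul_def sum_distrib_left)
  qed (auto simp: ginv_def mmul_def)
qed

section \<open>The involutions on the group and on the Lie algebra in coordinates\<close>

lemma Emat_eq: "Emat n i j = (if i < N \<and> j < N \<and> j = mir i then eps i else 0)"
  by (cases "i < n"; cases "j < n") (auto simp: Emat_def Jmat_def mir_def eps_def)

lemma mmul_Emat_left: "i < N \<Longrightarrow> j < N \<Longrightarrow> mmul N (Emat n) A i j = eps i * A (mir i) j"
proof -
  assume "i < N" "j < N"
  have "(\<Sum>k<N. Emat n i k * A k j) = (\<Sum>k<N. if k = mir i then eps i * A (mir i) j else 0)"
    using \<open>i < N\<close> by (intro sum.cong) (auto simp: Emat_eq)
  then show ?thesis
    using \<open>i < N\<close> \<open>j < N\<close> by (simp add: mmul_def)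
qed

lemma mmul_Emat_right: "i < N \<Longrightarrow> j < N \<Longrightarrow> mmul N A (Emat n) i j = - eps j * A i (mir j)"
proof -
  assume "i < N" "j < N"
  have "(\<Sum>k<N. A i k * Emat n k j) = (\<Sum>k<N. if k = mir j then - eps j * A i (mir j) else 0)"
    using \<open>j < N\<close> by (intro sum.cong) (auto simp: Emat_eq)
  then show ?thesis
    using \<open>i < N\<close> \<open>j < N\<close> by (simp add: mmul_def)
qed

lemma Emat_mtr_Emat: "mmul N (mmul N (Emat n) (mtr A)) (Emat n) = msmult (-1) (ginv A)"
proof (intro ext)
  fix i j
  show "mmul N (mmul N (Emat n) (mtr A)) (Emat n) i j = msmult (-1) (ginv A) i j"
  proof (cases "i < N \<and> j < N")
    case True
    then show ?thesis
      by (simp add: mmul_Emat_right mmul_Emat_left msmult_def ginv_def mtr_def)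
  qed (auto simp: mmul_def msmult_def ginv_def)
qed

lemma Emat_Emat: "mmul N (Emat n) (Emat n) = msmult (-1) (idm N)"
proof (intro ext)
  fix i j
  show "mmul N (Emat n) (Emat n) i j = msmult (-1) (idm N) i j"
  proof (cases "i < N \<and> j < N")
    case True
    then show ?thesis
      by (auto simp: mmul_Emat_right msmult_def Emat_eq idm_def)
  qed (auto simp: mmul_def msmult_def idm_def)
qed

lemma minv_Emat: "minv N (Emat n) = msmult (-1) (Emat n)"
proof (rule minv_eqI)
  show "is_mat N (msmult (-1) (Emat n))"
    by (auto simp: is_mat_def msmult_def Emat_eq)
qed (auto simp: mmul_msmult_left mmul_msmult_right Emat_Emat, auto simp: msmult_def)

lemma sigmaL_eq: "sigmaL n x = msmult (-1) (ginv x)"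
  by (simp add: sigmaL_def Emat_mtr_Emat)

lemma mtr_mmul: "mtr (mmul N A B) = mmul N (mtr B) (mtr A)"
  by (intro ext) (auto simp: mtr_def mmul_def mult.commute)

lemma mtr_idm [simp]: "mtr (idm N) = idm N"
  by (intro ext) (auto simp: mtr_def idm_def)

lemma is_mat_mtr: "is_mat N A \<Longrightarrow> is_mat N (mtr A)"
  by (auto simp: is_mat_def mtr_def)

lemma sigmaG_eq:
  assumes "is_mat N B" "mmul N A B = idm N" "mmul N B A = idm N"
  shows "sigmaG n A = ginv B"
proof -
  have "minv N (mtr A) = mtr B"
    by (rule minv_eqI)
       (use assms in \<open>auto simp: mtr_mmul[symmetric] is_mat_mtr\<close>)
  then show ?thesis
    by (simp add: sigmaG_def minv_Emat mmul_msmult_right Emat_mtr_Emat)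
       (simp add: msmult_def)
qed

text \<open>On determinant 1, \<open>sigmaG\<close> is \<open>ginv\<close> of the inverse. As
  \<open>ginv\<close> is an involution, being fixed by \<open>sigmaG\<close> amounts to
  \<open>ginv A\<close> being the inverse of \<open>A\<close>.\<close>

lemma GC_iff:
  "A \<in> GC n \<longleftrightarrow> is_mat N A \<and> mdet N A = 1 \<and> mmul N A (ginv A) = idm N \<and> mmul N (ginv A) A = idm N"
proof (cases "is_mat N A \<and> mdet N A = 1")
  case True
  then obtain B where B: "is_mat N B" "mmul N A B = idm N" "mmul N B A = idm N"
    using inverse_exists by blast
  have "sigmaG n A = A \<longleftrightarrow> ginv B = A"
    using sigmaG_eq[OF B] by simp
  also have "\<dots> \<longleftrightarrow> ginv A = B"
    using B True by auto
  also have "\<dots> \<longleftrightarrow> mmul N A (ginv A) = idm N \<and> mmul N (ginv A) A = idm N"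
    using B by (metis is_mat_ginv minv_eqI)
  finally show ?thesis
    using True by (simp add: GC_def SL_def)
qed (auto simp: GC_def SL_def)

lemma BC_iff: "A \<in> BC n \<longleftrightarrow> A \<in> GC n \<and> upper A"
  by (auto simp: BC_def Bor_def GC_def)

lemma GC_is_mat [simp]: "A \<in> GC n \<Longrightarrow> is_mat N A"
  and GC_ginv_right: "A \<in> GC n \<Longrightarrow> mmul N A (ginv A) = idm N"
  and GC_ginv_left: "A \<in> GC n \<Longrightarrow> mmul N (ginv A) A = idm N"
  by (auto simp: GC_iff)

lemma BC_GC: "A \<in> BC n \<Longrightarrow> A \<in> GC n"
  by (simp add: BC_iff)

lemma minv_GC: "A \<in> GC n \<Longrightarrow> minv N A = ginv A"
  by (intro minv_eqI) (auto simp: GC_iff)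

lemma mmul_cancel_left:
  "A \<in> GC n \<Longrightarrow> is_mat N B \<Longrightarrow> mmul N A (mmul N (ginv A) B) = B"
  "A \<in> GC n \<Longrightarrow> is_mat N B \<Longrightarrow> mmul N (ginv A) (mmul N A B) = B"
  by (simp_all add: mmul_assoc[symmetric] GC_ginv_left GC_ginv_right)

lemma mdet_idm [simp]: "mdet N (idm N) = 1"
  by (subst mdet_upper) (auto simp: idm_def)

lemma GC_idm [simp]: "idm N \<in> GC n"
  by (simp add: GC_iff)

lemma GC_mmul: assumes "A \<in> GC n" "B \<in> GC n" shows "mmul N A B \<in> GC n"
  using assms mmul_cancel_left[OF assms(1)] mmul_cancel_left[of "ginv B"]
  by (auto simp: GC_iff[of "mmul N A B"] ginv_mmul mmul_assoc mdet_mmul mmul_cancel_left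
      GC_ginv_left GC_ginv_right)
     (auto simp: GC_iff)

lemma GC_ginv: assumes "A \<in> GC n" shows "ginv A \<in> GC n"
proof -
  have "mdet N (ginv A) = mdet N A * mdet N (ginv A)"
    using assms by (simp add: GC_iff)
  also have "\<dots> = 1"
    using assms by (simp add: mdet_mmul[symmetric] GC_ginv_right)
  finally show ?thesis
    using assms by (simp add: GC_iff)
qed

lemma upper_mmul: "upper A \<Longrightarrow> upper B \<Longrightarrow> upper (mmul N A B)"
  unfolding upper_def mmul_def
  by (auto intro!: sum.neutral) (metis linorder_neqE_nat order.strict_trans)

lemma upper_ginv: "upper A \<Longrightarrow> upper (ginv A)"
  by (auto simp: upper_def ginv_def)

lemma BC_idm [simp]: "idm N \<in> BC n"
  by (simp add: BC_iff) (simp add: upper_def idm_def)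

lemma BC_mmul: "A \<in> BC n \<Longrightarrow> B \<in> BC n \<Longrightarrow> mmul N A B \<in> BC n"
  by (simp add: BC_iff GC_mmul upper_mmul)

lemma BC_ginv: "A \<in> BC n \<Longrightarrow> ginv A \<in> BC n"
  by (simp add: BC_iff GC_ginv upper_ginv)

lemma msmult_minus_minus: "msmult (-1) (msmult (-1) A) = A"
  by (simp add: msmult_def)

text \<open>Antisymmetry makes the diagonal entries at \<open>i\<close> and \<open>mir i\<close>
  opposite, so the trace cancels in pairs.\<close>

lemma gC_iff: "x \<in> gC n \<longleftrightarrow> is_mat N x \<and> ginv x = msmult (-1) x"
proof -
  have "mtrace N x = 0" if "ginv x = msmult (-1) x"
  proof -
    have "- x i i = x (mir i) (mir i)" if "i < N" for i
      using fun_cong[OF fun_cong[OF \<open>ginv x = msmult (-1) x\<close>, of i], of i] that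
      by (simp add: ginv_def msmult_def)
    then have "(\<Sum>i<N. - x i i) = (\<Sum>i<N. x (mir i) (mir i))"
      by (intro sum.cong) auto
    also have "\<dots> = (\<Sum>i<N. x i i)"
      by (rule sum_mir)
    finally show ?thesis
      by (simp add: mtrace_def sum_negf)
  qed
  moreover have "msmult (-1) (ginv x) = x \<longleftrightarrow> ginv x = msmult (-1) x"
    by (metis msmult_minus_minus)
  ultimately show ?thesis
    by (auto simp: gC_def sl_def sigmaL_eq)
qed

lemma gC_entry:
  assumes "x \<in> gC n" "i < N" "j < N"
  shows "x (mir j) (mir i) = - eps i * eps j * x i j"
proof -
  have "ginv x i j = msmult (-1) x i j"
    using assms by (simp add: gC_iff)
  then have "eps i * eps j * x (mir j) (mir i) = - x i j"
    using assms by (simp add: ginv_def msmult_def)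
  moreover have "x (mir j) (mir i) = eps i * eps j * (eps i * eps j * x (mir j) (mir i))"
    by (simp add: eps_def)
  ultimately show ?thesis
    by (metis mult_minus_left mult_minus_right)
qed

lemma gC_is_mat [simp]: "x \<in> gC n \<Longrightarrow> is_mat N x"
  by (simp add: gC_iff)

lemma gC_outside: "x \<in> gC n \<Longrightarrow> N \<le> i \<or> N \<le> j \<Longrightarrow> x i j = 0"
  by (auto simp: gC_iff is_mat_def)

lemma gC_I:
  assumes "is_mat N x" "\<And>i j. i < N \<Longrightarrow> j < N \<Longrightarrow> x (mir j) (mir i) = - eps i * eps j * x i j"
  shows "x \<in> gC n"
  using assms by (auto simp: gC_iff ginv_def msmult_def is_mat_def eps_def intro!: ext)

lemma gC_madd: "x \<in> gC n \<Longrightarrow> y \<in> gC n \<Longrightarrow> madd x y \<in> gC n"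
  by (auto intro!: gC_I simp: madd_def gC_entry is_mat_def gC_outside algebra_simps)

lemma gC_msmult: "x \<in> gC n \<Longrightarrow> msmult c x \<in> gC n"
  by (auto intro!: gC_I simp: msmult_def gC_entry is_mat_def gC_outside algebra_simps)

subsection \<open>Conjugation\<close>

text \<open>Written with \<open>ginv\<close> so that linearity and \<open>conj_mmul\<close> hold for
  all matrices; by \<open>minv_GC\<close> it is \<open>g^-1 y g\<close> on
  \<open>GC\<close>.\<close>

definition conj :: "cmat \<Rightarrow> cmat \<Rightarrow> cmat" where
  "conj g y = mmul N (mmul N (ginv g) y) g"

lemma conj_mmul: "conj (mmul N g h) y = conj h (conj g y)"
  by (simp add: conj_def ginv_mmul mmul_assoc)

lemma conj_madd: "conj g (madd x y) = madd (conj g x) (conj g y)"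
  by (simp add: conj_def mmul_madd_left mmul_madd_right)

lemma conj_msmult: "conj g (msmult c x) = msmult c (conj g x)"
  by (simp add: conj_def mmul_msmult_left mmul_msmult_right)

lemma conj_gC: "g \<in> GC n \<Longrightarrow> x \<in> gC n \<Longrightarrow> conj g x \<in> gC n"
  by (simp add: gC_iff conj_def ginv_mmul mmul_msmult_left mmul_msmult_right mmul_assoc)

lemma lcoset_mmul_BC:
  assumes "g \<in> GC n" "b \<in> BC n"
  shows "lcoset n (mmul N g b) = lcoset n g"
proof -
  have "\<exists>b''\<in>BC n. mmul N (mmul N g b) b' = mmul N g b''" if "b' \<in> BC n" for b'
    using that assms by (auto simp: mmul_assoc intro!: BC_mmul)
  moreover have "\<exists>b''\<in>BC n. mmul N g b' = mmul N (mmul N g b) b''" if "b' \<in> BC n" for b'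
    using that assms
    by (intro bexI[of _ "mmul N (ginv b) b'"])
       (auto simp: mmul_assoc mmul_cancel_left BC_GC intro!: BC_mmul BC_ginv)
  ultimately show ?thesis
    unfolding lcoset_def by blast
qed

lemma lcoset_eq_D:
  assumes "lcoset n g = lcoset n h" "h \<in> GC n"
  obtains b where "b \<in> BC n" "h = mmul N g b"
proof -
  have "h \<in> lcoset n h"
    using assms(2) by (auto simp: lcoset_def intro!: exI[of _ "idm N"])
  then show ?thesis
    using assms(1) that by (auto simp: lcoset_def)
qed

subsection \<open>Root vectors\<close>

lemma eps_square2 [simp]: "eps i * eps j * (eps i * eps j) = 1" "eps i * eps j * (eps j * eps i) = 1"
  by (simp_all add: eps_def)

text \<open>For \<^term>\<open>b = mir a\<close> the two terms coincide, so the long root vectors carry the coefficient 2.\<close>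

definition evec :: "nat \<Rightarrow> nat \<Rightarrow> cmat" where
  "evec a b = (\<lambda>i j. (if i = a \<and> j = b then 1 else 0)
      - eps a * eps b * (if i = mir b \<and> j = mir a then 1 else 0))"

lemma is_mat_evec [simp]: "a < N \<Longrightarrow> b < N \<Longrightarrow> is_mat N (evec a b)"
  by (auto simp: is_mat_def evec_def) (use mir_less linorder_not_le in blast)+

lemma evec_eq:
  assumes "a < N" "b < N"
  shows "evec a b i j = (if i = a \<and> j = b then if b = mir a then 2 else 1
    else if i = mir b \<and> j = mir a then - eps a * eps b else 0)"
proof (cases "b = mir a")
  case True
  show ?thesis
    using assms unfolding evec_def True by simp
next
  case False
  then have "a \<noteq> mir b"
    using assms by auto
  then show ?thesis
    using False by (auto simp: evec_def)
qed

lemma evec_gC [simp]: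
  assumes "a < N" "b < N"
  shows "evec a b \<in> gC n"
proof (rule gC_I)
  fix i j assume ij: "i < N" "j < N"
  \<comment> \<open>The mirror map, sending \<open>(i, j)\<close> to \<open>(mir j, mir i)\<close>,
    exchanges the two positions \<open>P\<close> and \<open>Q\<close> that support
    \<open>evec a b\<close>.\<close>
  obtain P Q where PQ: "(i = a \<and> j = b) = P" "(i = mir b \<and> j = mir a) = Q"
    by blast
  have mir: "(mir j = a \<and> mir i = b) = Q" "(mir j = mir b \<and> mir i = mir a) = P"
    using assms ij unfolding PQ[symmetric] by auto
  have "P \<or> Q \<longrightarrow> eps i * eps j = eps a * eps b"
    using assms unfolding PQ[symmetric] by auto
  then show "evec a b (mir j) (mir i) = - eps i * eps j * evec a b i j"
    unfolding evec_def PQ mir by (cases P; cases Q) (simp_all add: right_diff_distrib)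
qed (use assms in simp)

lemma evec_mir:
  assumes "a < N" "b < N"
  shows "evec (mir b) (mir a) = msmult (- eps a * eps b) (evec a b)"
  using assms by (intro ext) (auto simp: evec_def msmult_def)

lemma mmul_evec_left:
  assumes "a < N" "b < N" "i < N" "j < N"
  shows "mmul N (evec a b) y i j
    = (if i = a then y b j else 0) - eps a * eps b * (if i = mir b then y (mir a) j else 0)"
proof -
  have "evec a b i k * y k j = (if k = b then (if i = a then y b j else 0) else 0)
      - (if k = mir a then eps a * eps b * (if i = mir b then y (mir a) j else 0) else 0)" for k
    unfolding evec_def left_diff_distrib by (rule arg_cong2[of _ _ _ _ "(-)"]) auto
  then show ?thesis
    using assms by (simp add: mmul_def sum_subtractf)
qed

lemma mmul_evec_right:
  assumes "a < N" "b < N" "i < N" "j < N"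
  shows "mmul N y (evec a b) i j
    = (if j = b then y i a else 0) - eps a * eps b * (if j = mir a then y i (mir b) else 0)"
proof -
  have "y i k * evec a b k j = (if k = a then (if j = b then y i a else 0) else 0)
      - (if k = mir b then eps a * eps b * (if j = mir a then y i (mir b) else 0) else 0)" for k
    unfolding evec_def right_diff_distrib by (rule arg_cong2[of _ _ _ _ "(-)"]) auto
  then show ?thesis
    using assms by (simp add: mmul_def sum_subtractf)
qed

lemma bracket_outside: "N \<le> i \<or> N \<le> j \<Longrightarrow> bracket N x y i j = 0"
  by (auto simp: bracket_def msub_def mmul_def)

lemma bracket_evec:
  assumes "a < N" "b < N" "i < N" "j < N"
  shows "bracket N (evec a b) y i j
    = ((if i = a then y b j else 0) - eps a * eps b * (if i = mir b then y (mir a) j else 0))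
    - ((if j = b then y i a else 0) - eps a * eps b * (if j = mir a then y i (mir b) else 0))"
  using assms by (simp add: bracket_def msub_def mmul_evec_left mmul_evec_right)

lemma cmat_eqI:
  assumes "\<And>i j. i < N \<Longrightarrow> j < N \<Longrightarrow> A i j = B i j" "\<And>i j. N \<le> i \<or> N \<le> j \<Longrightarrow> A i j = B i j"
  shows "A = B"
  using assms by (intro ext) (meson linorder_not_le)

lemma evec_outside: "a < N \<Longrightarrow> b < N \<Longrightarrow> N \<le> i \<or> N \<le> j \<Longrightarrow> evec a b i j = 0"
  using is_mat_evec[of a b] by (auto simp: is_mat_def)

text \<open>Addition of roots. The factor 2 arises when one of the two vectors belongs to a long
  root and so carries coefficient 2; what matters later is that the factor is nonzero.\<close>

lemma bracket_evec_evec: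
  assumes "a < N" "c < N" "d < N" "a \<noteq> c" "a \<noteq> d" "c \<noteq> d"
  shows "bracket N (evec a c) (evec c d)
    = msmult (if d = mir c \<or> a = mir c then 2 else 1) (evec a d)"
proof (rule cmat_eqI)
  fix i j assume ij: "i < N" "j < N"
  consider (1) "d = mir c" "a \<noteq> mir c" | (2) "a = mir c" "d \<noteq> mir c" | (3) "d \<noteq> mir c" "a \<noteq> mir c"
    using assms by auto
  then show "bracket N (evec a c) (evec c d) i j
      = msmult (if d = mir c \<or> a = mir c then 2 else 1) (evec a d) i j"
  proof cases
    case 1
    then have "mir a \<noteq> c" using assms by (auto simp: mir_swap)
    then show ?thesis using 1 assms
      unfolding bracket_evec[OF assms(1,2) ij] by (simp add: msmult_def evec_def)
  next
    case 2
    then have "mir d \<noteq> c" "c \<noteq> mir d" using assms by (auto simp: mir_swap)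
    then show ?thesis using 2 assms
      unfolding bracket_evec[OF assms(1,2) ij] by (simp add: msmult_def evec_def)
  next
    case 3
    then have "mir d \<noteq> c" "c \<noteq> mir d" "mir a \<noteq> c" using assms by (auto simp: mir_swap)
    then show ?thesis using 3 assms
      unfolding bracket_evec[OF assms(1,2) ij] by (simp add: msmult_def evec_def)
  qed
qed (use assms in \<open>auto simp: bracket_outside msmult_def evec_outside\<close>)

text \<open>For distinct \<open>i\<close>, \<open>j\<close> in range this is the coroot of the root
  of \<open>evec i j\<close>, doubled for a long root, that is, for
  \<open>j = mir i\<close>.\<close>

definition fdiff :: "nat \<Rightarrow> nat \<Rightarrow> cmat" where
  "fdiff i j = madd (evec i i) (msmult (-1) (evec j j))"

lemma bracket_evec_opposite:
  assumes "c < N" "d < N" "c \<noteq> d"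
  shows "bracket N (evec d c) (evec c d) = msmult (if d = mir c then 2 else 1) (fdiff d c)"
proof (rule cmat_eqI)
  fix i j assume ij: "i < N" "j < N"
  show "bracket N (evec d c) (evec c d) i j = msmult (if d = mir c then 2 else 1) (fdiff d c) i j"
  proof (cases "d = mir c")
    case True
    then show ?thesis
      using assms unfolding bracket_evec[OF assms(2,1) ij]
      by (simp add: msmult_def madd_def fdiff_def evec_def)
  next
    case False
    then have "mir d \<noteq> c" "c \<noteq> mir d" using assms by (auto simp: mir_swap)
    then show ?thesis
      using False assms unfolding bracket_evec[OF assms(2,1) ij]
      by (simp add: msmult_def madd_def fdiff_def evec_def)
  qed
qed (use assms in \<open>auto simp: bracket_outside msmult_def fdiff_def madd_def evec_outside\<close>)

lemma bracket_evec_diagonal: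
  assumes "i < N" "j < N" "h \<in> gC n" "\<And>k l. k \<noteq> l \<Longrightarrow> h k l = 0"
  shows "bracket N (evec i j) h = msmult (h j j - h i i) (evec i j)"
proof (rule cmat_eqI)
  fix k l assume kl: "k < N" "l < N"
  obtain P Q where PQ: "(k = i \<and> l = j) = P" "(k = mir j \<and> l = mir i) = Q"
    by blast
  have e: "(if k = i then h j l else 0) = (if P then h j j else 0)"
    "(if l = j then h k i else 0) = (if P then h i i else 0)"
    "(if k = mir j then h (mir i) l else 0) = (if Q then - h i i else 0)"
    "(if l = mir i then h k (mir j) else 0) = (if Q then - h j j else 0)"
    using assms(4) gC_entry[OF assms(3), of i i] gC_entry[OF assms(3), of j j] assms(1,2)
    unfolding PQ[symmetric] by auto
  show "bracket N (evec i j) h k l = msmult (h j j - h i i) (evec i j) k l"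
    unfolding bracket_evec[OF assms(1,2) kl] unfolding msmult_def evec_def PQ e
    by (simp add: algebra_simps)
qed (use assms in \<open>auto simp: bracket_outside msmult_def evec_outside\<close>)

text \<open>The symplectic relation \<open>gC_entry\<close> fixes the mirror entry, leaving one free
  parameter; the division by 2 compensates for the coefficient of a long root vector.\<close>

lemma supported_on_root:
  assumes "y \<in> gC n" "a < N" "b < N" "a \<noteq> b"
    and "\<And>i j. y i j \<noteq> 0 \<Longrightarrow> (i = a \<and> j = b) \<or> (i = mir b \<and> j = mir a)"
  shows "y = msmult (y a b / (if b = mir a then 2 else 1)) (evec a b)"
proof (intro ext)
  fix i j
  have mir: "y (mir b) (mir a) = - eps a * eps b * y a b"
    using gC_entry[OF assms(1), of a b] assms by simp
  consider "i = a" "j = b" | "i = mir b" "j = mir a" "b \<noteq> mir a" "mir a \<noteq> b"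
    | "\<not> (i = a \<and> j = b)" "\<not> (i = mir b \<and> j = mir a)" "y i j = 0"
    using assms by (metis mir_mir)
  then show "y i j = msmult (y a b / (if b = mir a then 2 else 1)) (evec a b) i j"
  proof cases
    case 3
    then show ?thesis
      unfolding msmult_def evec_eq[OF assms(2,3)] by (simp only: if_False) simp
  qed (use mir in \<open>simp_all add: msmult_def evec_eq[OF assms(2,3)]\<close>)
qed

subsection \<open>Subspaces stable under the Borel subalgebra\<close>

definition subsp :: "cmat set \<Rightarrow> bool" where
  "subsp S \<longleftrightarrow> S \<subseteq> gC n \<and> zmat \<in> S
    \<and> (\<forall>x\<in>S. \<forall>y\<in>S. madd x y \<in> S) \<and> (\<forall>c. \<forall>x\<in>S. msmult c x \<in> S)"

lemma subspD:
  assumes "subsp S"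
  shows "x \<in> S \<Longrightarrow> x \<in> gC n" "zmat \<in> S" "x \<in> S \<Longrightarrow> y \<in> S \<Longrightarrow> madd x y \<in> S"
    "x \<in> S \<Longrightarrow> msmult c x \<in> S"
  using assms by (auto simp: subsp_def)

lemma subsp_msmult_cancel:
  assumes "subsp S" "msmult c x \<in> S" "c \<noteq> 0"
  shows "x \<in> S"
proof -
  have "x = msmult (1 / c) (msmult c x)"
    using assms(3) by (simp add: msmult_def)
  then show ?thesis
    using subspD(4)[OF assms(1,2)] by metis
qed

lemma subsp_sum:
  assumes "subsp S" "finite A" "\<And>p. p \<in> A \<Longrightarrow> f p \<in> S"
  shows "(\<lambda>i j. \<Sum>p\<in>A. f p i j) \<in> S"
  using assms(2,3)
proof (induction A rule: finite_induct)
  case empty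
  then show ?case
    using subspD(2)[OF assms(1)] by (simp add: zmat_def)
next
  case (insert p A)
  then have "madd (f p) (\<lambda>i j. \<Sum>p\<in>A. f p i j) \<in> S"
    by (intro subspD(3)[OF assms(1)]) auto
  then show ?case
    using insert by (simp add: madd_def)
qed

definition dg :: "cmat \<Rightarrow> cmat" where
  "dg y = (\<lambda>i j. if i = j then y i j else 0)"

text \<open>Summing \<open>y i j\<close> times \<open>evec i j\<close> over all off-diagonal
  positions counts each entry twice, once directly and once through its mirror, hence the factor
  \<open>1 / 2\<close>. For a long root the coefficient 2 of \<open>evec\<close> has the same
  effect.\<close>

lemma mem_subsp_of_components:
  assumes S: "subsp S" and y: "y \<in> gC n" and "dg y \<in> S"
    and off: "\<And>i j. i < N \<Longrightarrow> j < N \<Longrightarrow> i \<noteq> j \<Longrightarrow> y i j \<noteq> 0 \<Longrightarrow> evec i j \<in> S"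
  shows "y \<in> S"
proof -
  define P where "P = {(i, j). i < N \<and> j < N \<and> i \<noteq> j}"
  have fin: "finite P"
    by (rule finite_subset[of _ "{..<N} \<times> {..<N}"]) (auto simp: P_def)
  define z where "z = (\<lambda>k l. \<Sum>p\<in>P. msmult (y (fst p) (snd p)) (evec (fst p) (snd p)) k l)"
  have "msmult (y (fst p) (snd p)) (evec (fst p) (snd p)) \<in> S" if "p \<in> P" for p
  proof (cases "y (fst p) (snd p) = 0")
    case True
    then show ?thesis
      using subspD(2)[OF S] by (simp add: msmult_def zmat_def)
  next
    case False
    then show ?thesis
      using that off by (intro subspD(4)[OF S]) (auto simp: P_def)
  qed
  then have "z \<in> S"
    unfolding z_def by (intro subsp_sum[OF S fin]) auto
  moreover have "y = madd (dg y) (msmult (1 / 2) z)"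
  proof (rule cmat_eqI)
    fix k l assume kl: "k < N" "l < N"
    have "z k l = (\<Sum>p\<in>P. (if p = (k, l) then y k l else 0)
        + (if p = (mir l, mir k) then y k l else 0))"
      unfolding z_def
    proof (rule sum.cong[OF refl])
      fix p assume "p \<in> P"
      then obtain i j where p: "p = (i, j)" "i < N" "j < N" "i \<noteq> j"
        by (auto simp: P_def)
      obtain P Q where PQ: "(k = i \<and> l = j) = P" "(k = mir j \<and> l = mir i) = Q"
        by blast
      have pP: "(p = (k, l)) = P" and pQ: "(p = (mir l, mir k)) = Q"
        using p kl by (auto simp: PQ[symmetric])
      have "P \<longrightarrow> y i j = y k l" "Q \<longrightarrow> y i j * (eps i * eps j) = - y k l"
        using gC_entry[OF y, of i j] p(2,3) by (auto simp: PQ[symmetric])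
      then show "msmult (y (fst p) (snd p)) (evec (fst p) (snd p)) k l
          = (if p = (k, l) then y k l else 0) + (if p = (mir l, mir k) then y k l else 0)"
        unfolding pP pQ unfolding p(1) msmult_def evec_def PQ fst_conv snd_conv
        by (cases P; cases Q) (simp_all add: right_diff_distrib)
    qed
    also have "\<dots> = (if k = l then 0 else 2 * y k l)"
      using kl fin by (auto simp: sum.distrib P_def)
    finally show "y k l = madd (dg y) (msmult (1 / 2) z) k l"
      by (simp add: madd_def dg_def msmult_def)
  next
    fix k l assume kl: "N \<le> k \<or> N \<le> l"
    have "z k l = 0"
      unfolding z_def using kl by (intro sum.neutral) (auto simp: P_def msmult_def evec_outside)
    then show "y k l = madd (dg y) (msmult (1 / 2) z) k l"
      using gC_outside[OF y kl] by (auto simp: madd_def dg_def msmult_def)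
  qed
  ultimately show ?thesis
    using subspD(3,4)[OF S] \<open>dg y \<in> S\<close> by metis
qed

text \<open>Stability under positive root vectors alone; the torus part is kept apart as
  \<open>weight_closed\<close>. Both properties are shared by \<open>H\<close> and by the subspace
  \<open>K\<close> of the final argument.\<close>

definition raising :: "cmat set \<Rightarrow> bool" where
  "raising S \<longleftrightarrow> subsp S
    \<and> (\<forall>i j. i < j \<longrightarrow> j < N \<longrightarrow> (\<forall>h\<in>S. bracket N (evec i j) h \<in> S))"

lemma raising_subsp: "raising S \<Longrightarrow> subsp S"
  by (simp add: raising_def)

lemma raisingD: "raising S \<Longrightarrow> i < j \<Longrightarrow> j < N \<Longrightarrow> h \<in> S \<Longrightarrow> bracket N (evec i j) h \<in> S"
  by (auto simp: raising_def)

lemma evec_mir_mem: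
  assumes "subsp S" "a < N" "b < N"
  shows "evec (mir b) (mir a) \<in> S \<longleftrightarrow> evec a b \<in> S"
  using subsp_msmult_cancel[OF assms(1), of "- eps a * eps b" "evec a b"]
    subspD(4)[OF assms(1), of "evec a b" "- eps a * eps b"] assms(2,3)
  by (auto simp: evec_mir)

lemma raise_row:
  assumes "raising S" "evec c d \<in> S" "a \<le> c" "a \<noteq> d" "c < N" "d < N" "c \<noteq> d"
  shows "evec a d \<in> S"
proof (cases "a = c")
  case False
  then have "msmult (if d = mir c \<or> a = mir c then 2 else 1) (evec a d) \<in> S"
    using assms raisingD[OF assms(1), of a c "evec c d"] bracket_evec_evec[of a c d] by auto
  then show ?thesis
    by (rule subsp_msmult_cancel[OF raising_subsp[OF assms(1)]]) auto
qed (use assms in auto)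

text \<open>The mirror map turns rows into columns, so this is \<open>raise_row\<close> carried over
  by \<open>evec_mir_mem\<close>.\<close>

lemma raise_col:
  assumes "raising S" "evec c d \<in> S" "d \<le> b" "b \<noteq> c" "c < N" "d < N" "b < N" "c \<noteq> d"
  shows "evec c b \<in> S"
proof -
  note S = raising_subsp[OF assms(1)]
  have "evec (mir d) (mir c) \<in> S"
    using assms by (simp add: evec_mir_mem[OF S])
  then have "evec (mir b) (mir c) \<in> S"
    by (rule raise_row[OF assms(1)]) (use assms in auto)
  then show ?thesis
    using assms by (simp add: evec_mir_mem[OF S])
qed

lemma fdiff_mem:
  assumes "raising S" "evec c d \<in> S" "d < c" "c < N"
  shows "fdiff d c \<in> S"
proof -
  have "msmult (if d = mir c then 2 else 1) (fdiff d c) \<in> S"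
    using assms raisingD[OF assms(1), of d c "evec c d"] bracket_evec_opposite[of c d] by auto
  then show ?thesis
    by (rule subsp_msmult_cancel[OF raising_subsp[OF assms(1)]]) auto
qed

lemma evec_mem_of_diagonal:
  assumes "raising S" "h \<in> S" "\<And>k l. k \<noteq> l \<Longrightarrow> h k l = 0" "i < j" "j < N" "h i i \<noteq> h j j"
  shows "evec i j \<in> S"
proof -
  have "msmult (h j j - h i i) (evec i j) \<in> S"
    using assms raisingD[OF assms(1), of i j h] bracket_evec_diagonal[of i j h]
      subspD(1)[OF raising_subsp[OF assms(1)]] by auto
  then show ?thesis
    by (rule subsp_msmult_cancel[OF raising_subsp[OF assms(1)]]) (use assms(6) in auto)
qed

text \<open>One moves first along the row or first along the column, whichever intermediate
  position, \<open>(a, d)\<close> or \<open>(c, b)\<close>, is off the diagonal.\<close>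

lemma raise:
  assumes S: "raising S" and "evec c d \<in> S" "a \<le> c" "d \<le> b" "a \<noteq> b" "c \<noteq> d"
    "b < N" "c < N"
  shows "evec a b \<in> S"
proof -
  consider "a \<noteq> d" | "b \<noteq> c" | "a = d" "b = c"
    by blast
  then show ?thesis
  proof cases
    case 1
    then have "evec a d \<in> S"
      by (intro raise_row[OF S assms(2)]) (use assms in auto)
    then show ?thesis
      by (rule raise_col[OF S]) (use assms 1 in auto)
  next
    case 2
    then have "evec c b \<in> S"
      by (intro raise_col[OF S assms(2)]) (use assms in auto)
    then show ?thesis
      by (rule raise_row[OF S]) (use assms 2 in auto)
  next
    \<comment> \<open>Both intermediate positions are diagonal: the passage from a negative root to
      its opposite goes through the coroot, on which the root takes a nonzero value.\<close>
    case 3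
    then have "fdiff d c \<in> S"
      by (intro fdiff_mem[OF S assms(2)]) (use assms in auto)
    then show ?thesis
      by (rule evec_mem_of_diagonal[OF S])
         (use 3 assms in \<open>auto simp: fdiff_def madd_def msmult_def evec_def\<close>)
  qed
qed

subsection \<open>Weight components\<close>

text \<open>Lagrange interpolation: for the operator scaling entry \<open>(i, j)\<close> by
  \<open>c i j\<close>, the product of \<open>(c - mu) / (m - mu)\<close> over the other occurring
  eigenvalues \<open>mu\<close> projects onto the eigenspace of \<open>m\<close>.\<close>

lemma eigencomponent_mem:
  assumes S: "subsp S" and ch: "\<And>y. y \<in> S \<Longrightarrow> (\<lambda>i j. c i j * y i j) \<in> S" and y: "y \<in> S"
  shows "(\<lambda>i j. if c i j = m then y i j else 0) \<in> S"
proof -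
  define M where "M = (\<lambda>(i, j). c i j) ` ({..<N} \<times> {..<N}) - {m}"
  have fin: "finite M"
    by (simp add: M_def)
  have "(\<lambda>i j. (\<Prod>\<mu>\<in>F. c i j - \<mu>) * y i j) \<in> S" if "finite F" for F
    using that
  proof (induction F rule: finite_induct)
    case (insert \<mu> F)
    let ?z = "\<lambda>i j. (\<Prod>\<mu>\<in>F. c i j - \<mu>) * y i j"
    have "madd (\<lambda>i j. c i j * ?z i j) (msmult (- \<mu>) ?z) \<in> S"
      using insert.IH by (intro subspD(3,4)[OF S] ch)
    then show ?case
      using insert.hyps by (simp add: madd_def msmult_def algebra_simps)
  qed (use y in simp)
  from subspD(4)[OF S this[OF fin], of "1 / (\<Prod>\<mu>\<in>M. m - \<mu>)"]
  have "msmult (1 / (\<Prod>\<mu>\<in>M. m - \<mu>)) (\<lambda>i j. (\<Prod>\<mu>\<in>M. c i j - \<mu>) * y i j) \<in> S" .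
  also have "msmult (1 / (\<Prod>\<mu>\<in>M. m - \<mu>)) (\<lambda>i j. (\<Prod>\<mu>\<in>M. c i j - \<mu>) * y i j)
      = (\<lambda>i j. if c i j = m then y i j else 0)"
  proof (rule cmat_eqI)
    fix i j assume ij: "i < N" "j < N"
    have "(\<Prod>\<mu>\<in>M. m - \<mu>) \<noteq> 0"
      using fin by (auto simp: M_def)
    moreover have "(\<Prod>\<mu>\<in>M. c i j - \<mu>) = 0" if "c i j \<noteq> m"
      using that ij fin by (auto simp: M_def intro!: prod_zero)
    ultimately show "msmult (1 / (\<Prod>\<mu>\<in>M. m - \<mu>)) (\<lambda>i j. (\<Prod>\<mu>\<in>M. c i j - \<mu>) * y i j) i j
        = (if c i j = m then y i j else 0)"
      by (auto simp: msmult_def)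
  qed (use gC_outside[OF subspD(1)[OF S y]] in \<open>auto simp: msmult_def\<close>)
  finally show ?thesis .
qed

text \<open>The diagonal of \<open>evec a a\<close>, as integers: \<open>wt a i - wt a j\<close> is
  the weight of entry \<open>(i, j)\<close>. The same integers serve as eigenvalues of the Cartan
  subalgebra and as exponents for the torus.\<close>

definition wt :: "nat \<Rightarrow> nat \<Rightarrow> int" where
  "wt a i = (if i = a then 1 else if i = mir a then -1 else 0)"

text \<open>A common form for two sources of weight decompositions: brackets with the Cartan
  subalgebra for \<open>H\<close>, and conjugation by torus elements for \<open>K\<close>.\<close>

definition weight_closed :: "cmat set \<Rightarrow> bool" where
  "weight_closed S \<longleftrightarrow>
    (\<forall>a<N. \<forall>m. \<forall>y\<in>S. (\<lambda>i j. if wt a i - wt a j = m then y i j else 0) \<in> S)"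

lemma weight_closedD:
  "weight_closed S \<Longrightarrow> a < N \<Longrightarrow> y \<in> S \<Longrightarrow> (\<lambda>i j. if wt a i - wt a j = m then y i j else 0) \<in> S"
  by (auto simp: weight_closed_def)

text \<open>The weights for the two coordinates \<open>a\<close> and \<open>b\<close> already
  isolate position \<open>(a, b)\<close> and its mirror, so two projections leave a multiple of a
  root vector.\<close>

lemma root_component_mem:
  assumes S: "subsp S" and W: "weight_closed S" and y: "y \<in> S"
    and ab: "a < N" "b < N" "a \<noteq> b" "y a b \<noteq> 0"
  shows "evec a b \<in> S"
proof -
  define z where "z = (\<lambda>i j. if wt b i - wt b j = wt b a - wt b b then
      (if wt a i - wt a j = wt a a - wt a b then y i j else 0) else 0)"
  have z: "z \<in> S"
    unfolding z_def using ab y by (intro weight_closedD[OF W])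
  have "z = msmult (z a b / (if b = mir a then 2 else 1)) (evec a b)"
  proof (rule supported_on_root[OF subspD(1)[OF S z] ab(1-3)])
    fix i j assume "z i j \<noteq> 0"
    then have "wt b i - wt b j = wt b a - wt b b" "wt a i - wt a j = wt a a - wt a b"
      by (auto simp: z_def split: if_splits)
    note eq = this
    obtain a' b' where mir: "mir a = a'" "mir b = b'"
      by blast
    have *: "a \<noteq> a'" "b \<noteq> b'" "a' \<noteq> b'" "a \<noteq> b" "b = a' \<longleftrightarrow> a = b'"
      using ab by (auto simp: mir[symmetric])
    show "(i = a \<and> j = b) \<or> (i = mir b \<and> j = mir a)"
    \<comment> \<open>For a long root the weight for \<open>a\<close> is 2, which only one position
      attains; otherwise the weights 1 and -1 for \<open>a\<close> and \<open>b\<close> must be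
      combined.\<close>
    proof (cases "a = b'")
      case True
      then show ?thesis
        using eq(2) * unfolding wt_def mir by (simp split: if_splits)
    next
      case False
      then have "wt a a - wt a b = 1" "wt b a - wt b b = -1"
        using * unfolding wt_def mir by auto
      with eq have eq': "wt a i - wt a j = 1" "wt b i - wt b j = -1"
        by auto
      have "(i = a \<and> j \<noteq> a \<and> j \<noteq> a') \<or> (j = a' \<and> i \<noteq> a \<and> i \<noteq> a')"
        using eq'(1) unfolding wt_def mir by (simp split: if_splits)
      moreover have "(j = b \<and> i \<noteq> b \<and> i \<noteq> b') \<or> (i = b' \<and> j \<noteq> b \<and> j \<noteq> b')"
        using eq'(2) unfolding wt_def mir by (simp split: if_splits)
      ultimately show ?thesis
        using * False unfolding mir by blast
    qed
  qed
  then have "msmult (z a b / (if b = mir a then 2 else 1)) (evec a b) \<in> S"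
    using z by simp
  then show ?thesis
    by (rule subsp_msmult_cancel[OF S]) (use ab in \<open>auto simp: z_def\<close>)
qed

text \<open>Projection to weight 0 for one coordinate after another. Off the diagonal the weights
  \<open>wt i\<close> of \<open>i\<close> and \<open>j\<close> differ, so exactly the diagonal
  survives.\<close>

lemma diagonal_component_mem:
  assumes S: "subsp S" and W: "weight_closed S" and y: "y \<in> S"
  shows "dg y \<in> S"
proof -
  have "(\<lambda>i j. if \<forall>a<k. wt a i = wt a j then y i j else 0) \<in> S" if "k \<le> N" for k
    using that
  proof (induction k)
    case (Suc k)
    then have "(\<lambda>i j. if wt k i - wt k j = 0
        then (if \<forall>a<k. wt a i = wt a j then y i j else 0) else 0) \<in> S"
      by (intro weight_closedD[OF W]) auto
    also have "(\<lambda>i j. if wt k i - wt k j = 0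
        then (if \<forall>a<k. wt a i = wt a j then y i j else 0) else 0)
        = (\<lambda>i j. if \<forall>a<Suc k. wt a i = wt a j then y i j else 0)"
      by (intro ext) (auto simp: less_Suc_eq)
    finally show ?case .
  qed (use y in simp)
  from this[of N] have "(\<lambda>i j. if \<forall>a<N. wt a i = wt a j then y i j else 0) \<in> S"
    by simp
  also have "(\<lambda>i j. if \<forall>a<N. wt a i = wt a j then y i j else 0) = dg y"
  proof (rule cmat_eqI)
    fix i j assume "i < N" "j < N"
    then have "(\<forall>a<N. wt a i = wt a j) \<longleftrightarrow> i = j"
      by (auto dest!: spec[of _ i] simp: wt_def split: if_splits)
    then show "(if \<forall>a<N. wt a i = wt a j then y i j else 0) = dg y i j"
      by (simp add: dg_def)
  qed (use gC_outside[OF subspD(1)[OF S y]] in \<open>auto simp: dg_def\<close>)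
  finally show ?thesis .
qed

lemma upper_evec: "i \<le> j \<Longrightarrow> j < N \<Longrightarrow> upper (evec i j)"
  by (auto simp: upper_def evec_def)

lemma hessenberg_subsp: "hessenberg_C n H \<Longrightarrow> subsp H"
  by (auto simp: hessenberg_C_def subsp_def)

lemma hessenberg_raising: "hessenberg_C n H \<Longrightarrow> raising H"
  unfolding raising_def using hessenberg_subsp
  by (auto simp: hessenberg_C_def bC_def upper_evec)

lemma hessenberg_weight_closed:
  assumes H: "hessenberg_C n H"
  shows "weight_closed H"
  unfolding weight_closed_def
proof (intro allI impI ballI)
  fix a m y assume a: "a < N" and y: "y \<in> H"
  have "(\<lambda>i j. of_int (wt a i - wt a j) * z i j) \<in> H" if z: "z \<in> H" for z
  proof -
    have "bracket N (evec a a) z \<in> H"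
      using H z a by (auto simp: hessenberg_C_def bC_def upper_evec)
    also have "bracket N (evec a a) z = (\<lambda>i j. of_int (wt a i - wt a j) * z i j)"
    proof (rule cmat_eqI)
      fix i j assume "i < N" "j < N"
      then show "bracket N (evec a a) z i j = of_int (wt a i - wt a j) * z i j"
        using a by (auto simp: bracket_evec wt_def)
    next
      fix i j assume "N \<le> i \<or> N \<le> j"
      then show "bracket N (evec a a) z i j = of_int (wt a i - wt a j) * z i j"
        using gC_outside[OF subspD(1)[OF hessenberg_subsp[OF H] z], of i j]
        by (simp add: bracket_outside)
    qed
    finally show ?thesis .
  qed
  from eigencomponent_mem[OF hessenberg_subsp[OF H] this y, of "of_int m"]
  show "(\<lambda>i j. if wt a i - wt a j = m then y i j else 0) \<in> H"
    by (simp only: of_int_eq_iff)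
qed

subsection \<open>From the Borel subalgebra to the Borel subgroup\<close>

lemma BC_entry_zero: "b \<in> BC n \<Longrightarrow> j < i \<Longrightarrow> b i j = 0"
  by (simp add: BC_iff upper_def)

lemma conj_evec_entry:
  assumes "c < N" "d < N" "i < N" "j < N"
  shows "conj b (evec c d) i j
    = ginv b i c * b d j - eps c * eps d * (ginv b i (mir d) * b (mir c) j)"
proof -
  have "conj b (evec c d) i j = (\<Sum>k<N. mmul N (ginv b) (evec c d) i k * b k j)"
    using assms by (simp add: conj_def mmul_def[of N _ b])
  also have "\<dots> = (\<Sum>k<N. (if k = d then ginv b i c * b d j else 0)
      - (if k = mir c then eps c * eps d * (ginv b i (mir d) * b (mir c) j) else 0))"
  proof (rule sum.cong[OF refl])
    fix k assume "k \<in> {..<N}"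
    then have k: "k < N" by simp
    show "mmul N (ginv b) (evec c d) i k * b k j = (if k = d then ginv b i c * b d j else 0)
      - (if k = mir c then eps c * eps d * (ginv b i (mir d) * b (mir c) j) else 0)"
      unfolding mmul_evec_right[OF assms(1-3) k] left_diff_distrib
      by (rule arg_cong2[of _ _ _ _ "(-)"]) auto
  qed
  finally show ?thesis
    using assms by (simp add: sum_subtractf)
qed

text \<open>As \<open>b\<close> is upper triangular, a nonzero entry \<open>(i, j)\<close> of the
  conjugate lies above and to the right of \<open>(c, d)\<close> or of its mirror, so
  \<open>raise\<close> applies. The diagonal is handled separately, by coroots.\<close>

lemma conj_evec_mem:
  assumes S: "raising S" and e: "evec c d \<in> S" and b: "b \<in> BC n"
    and cd: "c < N" "d < N" "c \<noteq> d"
  shows "conj b (evec c d) \<in> S"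
proof (rule mem_subsp_of_components[OF raising_subsp[OF S]])
  let ?y = "conj b (evec c d)"
  note S' = raising_subsp[OF S]
  show "?y \<in> gC n"
    using b cd by (intro conj_gC) (auto simp: BC_GC)
  show "evec i j \<in> S" if ij: "i < N" "j < N" "i \<noteq> j" "?y i j \<noteq> 0" for i j
  proof -
    have "ginv b i c * b d j \<noteq> 0 \<or> ginv b i (mir d) * b (mir c) j \<noteq> 0"
      using ij cd by (auto simp: conj_evec_entry)
    then show ?thesis
    proof
      assume "ginv b i c * b d j \<noteq> 0"
      then have "i \<le> c" "d \<le> j"
        using BC_entry_zero[OF b, of j d] BC_entry_zero[OF BC_ginv[OF b], of c i]
        by (auto simp: not_less[symmetric])
      then show ?thesis
        using raise[OF S e] ij cd by blast
    next
      assume "ginv b i (mir d) * b (mir c) j \<noteq> 0"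
      then have *: "i \<le> mir d" "mir c \<le> j"
        using BC_entry_zero[OF b, of j "mir c"] BC_entry_zero[OF BC_ginv[OF b], of "mir d" i]
        by (auto simp: not_less[symmetric])
      have "evec (mir d) (mir c) \<in> S"
        using e cd by (simp add: evec_mir_mem[OF S'])
      then show ?thesis
        using raise[OF S _ *] ij cd by simp
    qed
  qed
  \<comment> \<open>The diagonal of the conjugate is the sum of \<open>z i\<close> times
    \<open>evec i i\<close>. The \<open>z i\<close> add up to entry \<open>(d, c)\<close> of
    \<open>b b^-1\<close>, which is 0, so the sum can be rewritten in terms of
    \<open>fdiff i c\<close>. Only \<open>i\<close> with \<open>d \<le> i\<close> and
    \<open>i \<le> c\<close> contribute, and for these \<open>evec c i\<close> is in
    \<open>S\<close> unless \<open>i = c\<close>.\<close>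
  define z where "z i = ginv b i c * b d i" for i
  have z0: "(\<Sum>i<N. z i) = 0"
  proof -
    have "(\<Sum>i<N. z i) = mmul N b (ginv b) d c"
      using cd by (simp add: mmul_def z_def mult.commute)
    also have "\<dots> = 0"
      using cd b by (simp add: GC_ginv_right[OF BC_GC] idm_def)
    finally show ?thesis .
  qed
  have zS: "msmult (z i) (fdiff i c) \<in> S" if "i < N" for i
  proof (cases "z i = 0 \<or> i = c")
    case True
    then have "msmult (z i) (fdiff i c) = zmat"
      by (auto simp: msmult_def zmat_def fdiff_def madd_def)
    then show ?thesis
      using subspD(2)[OF S'] by simp
  next
    case False
    then have "d \<le> i" "i \<le> c"
      using BC_entry_zero[OF b, of i d] BC_entry_zero[OF BC_ginv[OF b], of c i]
      by (auto simp: not_less[symmetric] z_def)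
    then have "evec c i \<in> S"
      using raise[OF S e, of c i] False that cd by auto
    then show ?thesis
      using False \<open>i \<le> c\<close> cd by (intro subspD(4)[OF S'] fdiff_mem[OF S]) auto
  qed
  have "dg ?y = (\<lambda>k l. \<Sum>i<N. msmult (z i) (fdiff i c) k l)"
  proof (rule cmat_eqI)
    fix k l assume kl: "k < N" "l < N"
    show "dg ?y k l = (\<Sum>i<N. msmult (z i) (fdiff i c) k l)"
    proof (cases "k = l")
      case False
      then show ?thesis
        by (auto simp: dg_def msmult_def fdiff_def madd_def evec_def intro!: sum.neutral)
    next
      case True
      have "(\<Sum>i<N. msmult (z i) (fdiff i c) k k)
          = (\<Sum>i<N. z i * evec i i k k) - (\<Sum>i<N. z i) * evec c c k k"
        by (simp add: msmult_def fdiff_def madd_def sum_subtractf right_diff_distrib sum_distrib_right)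
      also have "\<dots> = (\<Sum>i<N. (if i = k then z k else 0) - (if i = mir k then z (mir k) else 0))"
        using kl z0 by (auto simp: evec_def right_diff_distrib intro!: sum.cong)
      also have "\<dots> = z k - z (mir k)"
        using kl by (simp add: sum_subtractf)
      also have "\<dots> = ?y k k"
        using kl cd by (simp add: conj_evec_entry z_def ginv_def)
      finally show ?thesis
        using True by (simp add: dg_def)
    qed
  next
    fix k l assume kl: "N \<le> k \<or> N \<le> l"
    then have "?y k l = 0"
      by (auto simp: conj_def mmul_def)
    moreover have "msmult (z i) (fdiff i c) k l = 0" if "i < N" for i
      using kl that cd by (simp add: msmult_def fdiff_def madd_def evec_outside)
    ultimately show "dg ?y k l = (\<Sum>i<N. msmult (z i) (fdiff i c) k l)"
      by (auto simp: dg_def)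
  qed
  also have "\<dots> \<in> S"
    using zS by (intro subsp_sum[OF S']) auto
  finally show "dg ?y \<in> S" .
qed

text \<open>If \<open>h\<close> is constant on the indices from \<open>i\<close> to
  \<open>j\<close>, entry \<open>(i, j)\<close> of the conjugate is that of a scalar matrix.
  Otherwise two differing values give a root vector \<open>evec i k\<close> in \<open>S\<close>,
  which raises to \<open>evec i j\<close>.\<close>

lemma conj_diagonal_mem:
  assumes S: "raising S" and h: "h \<in> S" "\<And>k l. k \<noteq> l \<Longrightarrow> h k l = 0" and b: "b \<in> BC n"
  shows "conj b h \<in> S"
proof (rule mem_subsp_of_components[OF raising_subsp[OF S]])
  let ?y = "conj b h"
  have hg: "h \<in> gC n"
    using subspD(1)[OF raising_subsp[OF S] h(1)] .
  show "?y \<in> gC n"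
    using b hg by (intro conj_gC) (auto simp: BC_GC)
  have entry: "?y i j = (\<Sum>k<N. ginv b i k * h k k * b k j)" if "i < N" "j < N" for i j
  proof -
    have "mmul N (ginv b) h i k = ginv b i k * h k k" if "k < N" for k
    proof -
      have "(\<Sum>l<N. ginv b i l * h l k) = (\<Sum>l<N. if l = k then ginv b i k * h k k else 0)"
        using h(2) by (intro sum.cong) auto
      then show ?thesis
        using that \<open>i < N\<close> by (simp add: mmul_def)
    qed
    then show ?thesis
      using that by (simp add: conj_def mmul_def[of N _ b])
  qed
  have inv_entry: "(\<Sum>k<N. ginv b i k * b k j) = (if i = j then 1 else 0)" if "i < N" "j < N" for i j
  proof -
    have "(\<Sum>k<N. ginv b i k * b k j) = mmul N (ginv b) b i j"
      using that by (simp add: mmul_def)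
    then show ?thesis
      using that b by (simp add: GC_ginv_left[OF BC_GC] idm_def)
  qed
  have const: "?y i j = h i i * (if i = j then 1 else 0)"
    if ij: "i < N" "j < N" and c: "\<And>k. i < k \<Longrightarrow> k \<le> j \<Longrightarrow> h k k = h i i" for i j
  proof -
    have "?y i j = (\<Sum>k<N. h i i * (ginv b i k * b k j))"
      unfolding entry[OF ij]
    proof (rule sum.cong[OF refl])
      fix k
      show "ginv b i k * h k k * b k j = h i i * (ginv b i k * b k j)"
        using c[of k] BC_entry_zero[OF b, of j k] BC_entry_zero[OF BC_ginv[OF b], of k i]
        by (cases "k < i"; cases "j < k"; cases "k = i") auto
    qed
    then show ?thesis
      using inv_entry[OF ij] by (simp add: sum_distrib_left[symmetric])
  qed
  show "evec i j \<in> S" if ij: "i < N" "j < N" "i \<noteq> j" "?y i j \<noteq> 0" for i j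
  proof -
    obtain k where k: "i < k" "k \<le> j" "h k k \<noteq> h i i"
      using const[OF ij(1,2)] ij(3,4) by auto
    then have "evec i k \<in> S"
      using ij by (intro evec_mem_of_diagonal[OF S h]) auto
    then show ?thesis
      by (rule raise[OF S]) (use k ij in auto)
  qed
  have "dg ?y = h"
  proof (rule cmat_eqI)
    fix i j assume "i < N" "j < N"
    then show "dg ?y i j = h i j"
      using const[of i i] h(2) by (auto simp: dg_def)
  next
    fix i j assume "N \<le> i \<or> N \<le> j"
    then show "dg ?y i j = h i j"
      using gC_outside[OF hg] by (auto simp: dg_def conj_def mmul_def)
  qed
  then show "dg ?y \<in> S"
    using h by simp
qed

lemma zmat_gC: "zmat \<in> gC n"
  by (rule gC_I) (auto simp: zmat_def is_mat_def)

lemma conj_zmat: "conj g zmat = zmat"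
  by (intro ext) (simp add: conj_def mmul_def zmat_def)

lemma subsp_vimage_conj:
  assumes "subsp S" "g \<in> GC n"
  shows "subsp {y \<in> gC n. conj g y \<in> S}"
  using assms by (auto simp: subsp_def zmat_gC conj_zmat conj_madd conj_msmult gC_madd gC_msmult)

text \<open>Passage from the Borel subalgebra to the Borel subgroup without exponentials: each
  weight component of \<open>h\<close> is treated by an entrywise argument.\<close>

lemma conj_mem:
  assumes S: "raising S" "weight_closed S" and b: "b \<in> BC n" and h: "h \<in> S"
  shows "conj b h \<in> S"
proof -
  note S' = raising_subsp[OF S(1)]
  have dgh: "dg h \<in> S"
    by (rule diagonal_component_mem[OF S' S(2) h])
  have "h \<in> {y \<in> gC n. conj b y \<in> S}"
  proof (rule mem_subsp_of_components[OF subsp_vimage_conj[OF S' BC_GC[OF b]]])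
    show "dg h \<in> {y \<in> gC n. conj b y \<in> S}"
      using conj_diagonal_mem[OF S(1) dgh _ b] subspD(1)[OF S' dgh] by (auto simp: dg_def)
  next
    fix i j assume ij: "i < N" "j < N" "i \<noteq> j" "h i j \<noteq> 0"
    then have "evec i j \<in> S"
      by (intro root_component_mem[OF S' S(2) h])
    then show "evec i j \<in> {y \<in> gC n. conj b y \<in> S}"
      using conj_evec_mem[OF S(1) _ b] ij by auto
  qed (rule subspD(1)[OF S' h])
  then show ?thesis by simp
qed

text \<open>Stability of \<open>H\<close> under \<open>BC\<close> makes the membership condition
  independent of the representative of the coset.\<close>

lemma hess_var_iff:
  assumes H: "hessenberg_C n H" and g: "g \<in> GC n"
  shows "lcoset n g \<in> hess_var n x H \<longleftrightarrow> conj g x \<in> H"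
proof
  assume "lcoset n g \<in> hess_var n x H"
  then obtain g' where g': "lcoset n g = lcoset n g'" "g' \<in> GC n" "conj g' x \<in> H"
    by (auto simp: hess_var_def minv_GC conj_def)
  then obtain b where "b \<in> BC n" "g = mmul N g' b"
    using lcoset_eq_D[OF g'(1)[symmetric] g] by blast
  then show "conj g x \<in> H"
    using conj_mem[OF hessenberg_raising[OF H] hessenberg_weight_closed[OF H] _ g'(3)]
    by (simp add: conj_mmul)
qed (use g in \<open>auto simp: hess_var_def minv_GC conj_def\<close>)

subsection \<open>Root subgroups and representatives of reflections\<close>

text \<open>For distinct indices in range this is the exponential of \<open>s\<close> times
  \<open>evec i j\<close>, since the square of the root vector vanishes.\<close>

definition unip :: "nat \<Rightarrow> nat \<Rightarrow> complex \<Rightarrow> cmat" where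
  "unip i j s = madd (idm N) (msmult s (evec i j))"

lemma evec_evec_zero:
  assumes "i < N" "j < N" "i \<noteq> j"
  shows "mmul N (evec i j) (evec i j) = zmat"
proof (rule cmat_eqI)
  fix k l assume kl: "k < N" "l < N"
  have "evec i j j l = 0" "evec i j (mir i) l = 0"
    using assms by (auto simp: evec_def)
  then show "mmul N (evec i j) (evec i j) k l = zmat k l"
    unfolding mmul_evec_left[OF assms(1,2) kl] by (simp add: zmat_def)
qed (auto simp: mmul_def zmat_def)

lemma is_mat_unip [simp]: "i < N \<Longrightarrow> j < N \<Longrightarrow> is_mat N (unip i j s)"
  using is_mat_evec[of i j] by (auto simp: unip_def is_mat_def madd_def msmult_def idm_def)

lemma ginv_madd: "ginv (madd A B) = madd (ginv A) (ginv B)"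
  by (intro ext) (simp add: ginv_def madd_def distrib_left)

lemma ginv_msmult: "ginv (msmult c A) = msmult c (ginv A)"
  by (intro ext) (simp add: ginv_def msmult_def mult_ac)

lemma ginv_unip:
  assumes "i < N" "j < N"
  shows "ginv (unip i j s) = unip i j (- s)"
proof -
  have "ginv (evec i j) = msmult (-1) (evec i j)"
    using evec_gC[OF assms] by (simp add: gC_iff)
  then show ?thesis
    by (simp add: unip_def ginv_madd ginv_msmult) (simp add: msmult_def)
qed

lemma unip_mmul_unip:
  assumes "i < N" "j < N" "i \<noteq> j"
  shows "mmul N (unip i j s) (unip i j t) = unip i j (s + t)"
  using assms unfolding unip_def
  by (simp add: mmul_madd_left mmul_madd_right mmul_msmult_left mmul_msmult_right evec_evec_zero)
     (auto simp: madd_def msmult_def zmat_def algebra_simps)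

lemma unip_zero [simp]: "unip i j 0 = idm N"
  by (intro ext) (simp add: unip_def madd_def msmult_def)

lemma evec_diagonal_zero: "i < N \<Longrightarrow> j < N \<Longrightarrow> i \<noteq> j \<Longrightarrow> evec i j k k = 0"
  by (auto simp: evec_def)

lemma unip_upper: "i < j \<Longrightarrow> j < N \<Longrightarrow> upper (unip i j s)"
  using upper_evec[of i j] by (auto simp: upper_def unip_def madd_def msmult_def idm_def)

lemma mdet_unip:
  assumes "i < N" "j < N" "i \<noteq> j"
  shows "mdet N (unip i j s) = 1"
proof -
  have "mdet N (unip i j s) = (\<Prod>k<N. unip i j s k k)"
  proof (cases "i < j")
    case True
    then show ?thesis
      using unip_upper[of i j s] assms by (intro mdet_upper) (auto simp: upper_def)
  next
    case False
    show ?thesis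
    proof (rule mdet_lower)
      fix k l :: nat assume "k < l" "l < N"
      then show "unip i j s k l = 0"
        using False assms by (auto simp: unip_def madd_def msmult_def idm_def evec_def)
    qed
  qed
  also have "\<dots> = 1"
    using assms by (intro prod.neutral)
      (auto simp: unip_def madd_def msmult_def idm_def evec_diagonal_zero)
  finally show ?thesis .
qed

lemma unip_GC: "i < N \<Longrightarrow> j < N \<Longrightarrow> i \<noteq> j \<Longrightarrow> unip i j s \<in> GC n"
  by (simp add: GC_iff mdet_unip ginv_unip unip_mmul_unip)

lemma unip_BC: "i < j \<Longrightarrow> j < N \<Longrightarrow> unip i j s \<in> BC n"
  by (simp add: BC_iff unip_GC unip_upper)

text \<open>The reflection in the Weyl group: a product of two mirror transpositions, or a single
  one if \<open>j = mir i\<close>.\<close>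

definition mswap :: "nat \<Rightarrow> nat \<Rightarrow> nat \<Rightarrow> nat" where
  "mswap i j k = (if k = i then j else if k = j then i
    else if k = mir i then mir j else if k = mir j then mir i else k)"

text \<open>The relation \<open>e f e = e\<close> for opposite root vectors of \<open>sl2\<close>.
  For a long root \<open>e\<close> and \<open>f\<close> are both doubled, which gives the factor
  4.\<close>

lemma evec_triple:
  assumes "i < N" "j < N" "i \<noteq> j"
  shows "mmul N (evec i j) (mmul N (evec j i) (evec i j))
    = msmult (if j = mir i then 4 else 1) (evec i j)"
proof (rule cmat_eqI)
  fix k l assume kl: "k < N" "l < N"
  note e = mmul_evec_left[OF assms(1,2) kl] mmul_evec_left[OF assms(2,1) assms(2) kl(2)]
    mmul_evec_left[OF assms(2,1) mir_less[OF assms(1)] kl(2)]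
  show "mmul N (evec i j) (mmul N (evec j i) (evec i j)) k l
      = msmult (if j = mir i then 4 else 1) (evec i j) k l"
  proof (cases "j = mir i")
    case True
    then show ?thesis
      using assms kl unfolding e by (simp add: msmult_def evec_def)
  next
    case False
    then have "i \<noteq> mir j" "mir i \<noteq> j" "mir j \<noteq> i"
      using assms by auto
    then show ?thesis
      using assms kl False unfolding e by (simp add: msmult_def evec_def)
  qed
qed (use assms in \<open>auto simp: mmul_def msmult_def evec_outside\<close>)

text \<open>The \<open>sl2\<close> product that represents a reflection once \<open>p\<close> and
  \<open>q\<close> are reciprocal, up to the factor 4 for a long root.\<close>

definition rmat :: "nat \<Rightarrow> nat \<Rightarrow> complex \<Rightarrow> complex \<Rightarrow> cmat" where
  "rmat i j p q = mmul N (unip i j (- p)) (mmul N (unip j i q) (unip i j (- p)))"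

lemma rmat_GC: "i < N \<Longrightarrow> j < N \<Longrightarrow> i \<noteq> j \<Longrightarrow> rmat i j p q \<in> GC n"
  by (simp add: rmat_def GC_mmul unip_GC)

lemma rmat_eq:
  assumes "i < N" "j < N" "i \<noteq> j" "p * q * (if j = mir i then 4 else 1) = 1"
  shows "rmat i j p q k l = idm N k l - p * evec i j k l + q * evec j i k l
    - p * q * (mmul N (evec i j) (evec j i) k l + mmul N (evec j i) (evec i j) k l)"
proof (cases "j = mir i")
  case True
  then have "p * (p * (q * 4)) = p"
    using assms(4) by (simp add: mult_ac)
  then have "p * (p * (q * (4 * c))) = p * c" for c
    by (metis mult.assoc)
  then show ?thesis
    unfolding rmat_def unip_def
    by (simp add: mmul_madd_left mmul_madd_right mmul_msmult_left mmul_msmult_right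
        evec_evec_zero[OF assms(1-3)] evec_triple[OF assms(1-3)] assms(1,2))
       (simp add: madd_def msmult_def zmat_def algebra_simps True)
next
  case False
  then have "p * (p * q) = p"
    using assms(4) by simp
  then have "p * (p * (q * c)) = p * c" for c
    by (metis mult.assoc)
  then show ?thesis
    unfolding rmat_def unip_def
    by (simp add: mmul_madd_left mmul_madd_right mmul_msmult_left mmul_msmult_right
        evec_evec_zero[OF assms(1-3)] evec_triple[OF assms(1-3)] assms(1,2))
       (simp add: madd_def msmult_def zmat_def algebra_simps False)
qed

lemma rmat_nonzero_iff:
  assumes "i < N" "j < N" "i \<noteq> j" "p * q * (if j = mir i then 4 else 1) = 1"
    and kl: "k < N" "l < N"
  shows "rmat i j p q k l \<noteq> 0 \<longleftrightarrow> k = mswap i j l"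
proof (cases "j = mir i")
  case True
  have p: "p \<noteq> 0" "q \<noteq> 0" "4 * (p * q) = 1"
    using assms(4) True by (auto simp: mult_ac)
  have d: "i \<noteq> mir i" "mir i \<noteq> i" "eps i * eps (mir i) = -1" "eps (mir i) * eps i = -1"
    using assms(1) by auto
  have "rmat i j p q k l = (if k = l then 1 else 0) - 2 * p * (if k = i \<and> l = mir i then 1 else 0)
      + 2 * q * (if k = mir i \<and> l = i then 1 else 0)
      - 4 * (p * q) * ((if k = i \<and> l = i then 1 else 0) + (if k = mir i \<and> l = mir i then 1 else 0))"
    unfolding rmat_eq[OF assms(1-4)] mmul_evec_left[OF assms(1,2) kl] mmul_evec_left[OF assms(2,1) kl]
    using True d kl assms(1) by (simp add: evec_def idm_def)
  then show ?thesis
    using p d True assms(1) unfolding mswap_def by (auto split: if_splits)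
next
  case False
  have p: "p \<noteq> 0" "q \<noteq> 0" "p * q = 1"
    using assms(4) False by auto
  obtain i' j' where m: "mir i = i'" "mir j = j'"
    by blast
  have d: "i \<noteq> i'" "j \<noteq> j'" "i \<noteq> j'" "j \<noteq> i'" "i' \<noteq> j'"
    "i' \<noteq> i" "j' \<noteq> j" "j' \<noteq> i" "i' \<noteq> j" "j' \<noteq> i'" "j \<noteq> i"
    using assms(1-3) False by (auto simp: m[symmetric])
  define e where "e = eps i * eps j"
  have e: "eps i * eps j = e" "eps j * eps i = e" "e * e = 1" "e \<noteq> 0"
    by (auto simp: e_def)
  have r: "rmat i j p q k l = (if k = l then 1 else 0)
      - p * ((if k = i \<and> l = j then 1 else 0) - e * (if k = j' \<and> l = i' then 1 else 0))
      + q * ((if k = j \<and> l = i then 1 else 0) - e * (if k = i' \<and> l = j' then 1 else 0))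
      - (((if k = i \<and> l = i then 1 else 0) + (if k = j' \<and> l = j' then 1 else 0))
        + ((if k = j \<and> l = j then 1 else 0) + (if k = i' \<and> l = i' then 1 else 0)))"
    unfolding rmat_eq[OF assms(1-4)] mmul_evec_left[OF assms(1,2) kl] mmul_evec_left[OF assms(2,1) kl]
    unfolding evec_def m e p(3)
    using d e kl by (simp add: idm_def)
  consider "l = i" | "l = j" | "l = i'" | "l = j'"
    | "l \<noteq> i" "l \<noteq> j" "l \<noteq> i'" "l \<noteq> j'"
    by blast
  then show ?thesis
    unfolding r mswap_def m by cases (use d e p in simp_all)
qed

lemma mswap_mswap:
  assumes "i < N" "j < N" "i \<noteq> j"
  shows "mswap i j (mswap i j k) = k"
proof (cases "j = mir i")
  case True
  then show ?thesis
    using assms by (simp add: mswap_def)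
next
  case False
  obtain i' j' where m: "mir i = i'" "mir j = j'"
    by blast
  have d: "i \<noteq> i'" "j \<noteq> j'" "i \<noteq> j'" "j \<noteq> i'" "i' \<noteq> j'"
    using assms False by (auto simp: m[symmetric])
  then show ?thesis
    using assms unfolding mswap_def m by simp
qed

lemma mswap_mir:
  assumes "i < N" "j < N" "i \<noteq> j" "k < N"
  shows "mswap i j (mir k) = mir (mswap i j k)"
proof (cases "j = mir i")
  case True
  obtain k' where k: "mir k = k'"
    by blast
  have "k' = i \<longleftrightarrow> k = mir i" "k' = mir i \<longleftrightarrow> k = i"
    using assms by (auto simp: k[symmetric])
  then show ?thesis
    using assms True k by (simp add: mswap_def)
next
  case False
  obtain i' j' k' where m: "mir i = i'" "mir j = j'" "mir k = k'"
    by blast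
  have d: "i \<noteq> i'" "j \<noteq> j'" "i \<noteq> j'" "j \<noteq> i'" "i' \<noteq> j'"
    "k' = i \<longleftrightarrow> k = i'" "k' = j \<longleftrightarrow> k = j'" "k' = i' \<longleftrightarrow> k = i" "k' = j' \<longleftrightarrow> k = j"
    "mir i' = i" "mir j' = j"
    using assms False by (auto simp: m[symmetric])
  then show ?thesis
    using assms unfolding mswap_def m by (simp add: m)
qed

section \<open>The Weyl group of signed permutations and its monomial representatives\<close>

lemma WC_permutes: "w \<in> WC n \<Longrightarrow> w permutes {..<N}"
  by (simp add: WC_def)

lemma WC_less [simp]: "w \<in> WC n \<Longrightarrow> w i < N \<longleftrightarrow> i < N"
  using permutes_in_image[OF WC_permutes] by auto

lemma WC_inj: "w \<in> WC n \<Longrightarrow> w i = w j \<longleftrightarrow> i = j"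
  using permutes_inj[OF WC_permutes] by (auto simp: inj_def)

lemma WC_mir: "w \<in> WC n \<Longrightarrow> i < N \<Longrightarrow> w (mir i) = mir (w i)"
  by (simp add: WC_def mir_def)

lemma WC_I:
  assumes "w permutes {..<N}" "\<And>i. i < N \<Longrightarrow> w (mir i) = mir (w i)"
  shows "w \<in> WC n"
  using assms by (simp add: WC_def mir_def)

lemma WC_comp: "u \<in> WC n \<Longrightarrow> v \<in> WC n \<Longrightarrow> u \<circ> v \<in> WC n"
  by (rule WC_I) (auto simp: WC_mir dest: WC_permutes intro: permutes_compose)

lemma WC_inv: assumes "w \<in> WC n" shows "inv w \<in> WC n"
proof (rule WC_I)
  show "inv w permutes {..<N}"
    using WC_permutes[OF assms] by (rule permutes_inv)
  fix i assume i: "i < N"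
  have "w (inv w k) = k" for k
    using permutes_inverses(1)[OF WC_permutes[OF assms]] .
  moreover have "inv w i < N"
    using permutes_in_image[OF permutes_inv[OF WC_permutes[OF assms]], of i] i by simp
  ultimately have "w (mir (inv w i)) = mir i"
    by (simp add: WC_mir[OF assms])
  then show "inv w (mir i) = mir (inv w i)"
    using permutes_inverses(2)[OF WC_permutes[OF assms]] by metis
qed

lemma mswap_WC:
  assumes "i < N" "j < N" "i \<noteq> j"
  shows "mswap i j \<in> WC n"
proof (rule WC_I)
  have "bij (mswap i j)"
    using mswap_mswap[OF assms] by (intro o_bij[of "mswap i j"]) (auto simp: fun_eq_iff)
  moreover have "mswap i j k = k" if "k \<notin> {..<N}" for k
    using that assms by (auto simp: mswap_def)
  ultimately show "mswap i j permutes {..<N}"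
    by (simp add: permutes_def bij_iff)
qed (use mswap_mir assms in auto)

lemma reps_GC: "d \<in> reps n u \<Longrightarrow> d \<in> GC n"
  by (simp add: reps_def)

lemma reps_nonzero: "d \<in> reps n u \<Longrightarrow> i < N \<Longrightarrow> j < N \<Longrightarrow> d i j \<noteq> 0 \<longleftrightarrow> i = u j"
  by (simp add: reps_def)

lemma mmul_reps_right:
  assumes "d \<in> reps n u" "u \<in> WC n" "k < N" "l < N"
  shows "mmul N A d k l = A k (u l) * d (u l) l"
proof -
  have "(\<Sum>m<N. A k m * d m l) = (\<Sum>m<N. if m = u l then A k (u l) * d (u l) l else 0)"
    using assms reps_nonzero[OF assms(1) _ assms(4)] by (intro sum.cong) auto
  then show ?thesis
    using assms by (simp add: mmul_def)
qed

lemma reps_mmul: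
  assumes "d \<in> reps n u" "e \<in> reps n v" "v \<in> WC n"
  shows "mmul N d e \<in> reps n (u \<circ> v)"
proof -
  have "mmul N d e \<in> GC n"
    using assms by (simp add: GC_mmul reps_GC)
  moreover have "mmul N d e k l \<noteq> 0 \<longleftrightarrow> k = (u \<circ> v) l" if "k < N" "l < N" for k l
    using that assms reps_nonzero[OF assms(1), of k "v l"] reps_nonzero[OF assms(2), of "v l" l]
    by (simp add: mmul_reps_right[OF assms(2,3)])
  ultimately show ?thesis
    by (simp add: reps_def)
qed

lemma rmat_reps:
  assumes "i < N" "j < N" "i \<noteq> j" "p * q * (if j = mir i then 4 else 1) = 1"
  shows "rmat i j p q \<in> reps n (mswap i j)"
  using assms by (simp add: reps_def rmat_GC rmat_nonzero_iff)

text \<open>Induction on the number of moved points: composing with the reflection that exchanges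
  \<open>k\<close> and \<open>w k\<close> fixes \<open>k\<close> and unfixes nothing, and
  representatives multiply.\<close>

lemma reps_nonempty:
  assumes "w \<in> WC n"
  shows "reps n w \<noteq> {}"
  using assms
proof (induction "card {i. i < N \<and> w i \<noteq> i}" arbitrary: w rule: less_induct)
  case less
  show ?case
  proof (cases "\<exists>k<N. w k \<noteq> k")
    case False
    then have "idm N \<in> reps n w"
      by (auto simp: reps_def) (auto simp: idm_def split: if_splits)
    then show ?thesis by blast
  next
    case True
    then obtain k where k: "k < N" "w k \<noteq> k"
      by blast
    define s where "s = mswap k (w k)"
    have wk: "w k < N" "k \<noteq> w k"
      using k less.prems by auto
    have s: "s \<in> WC n"
      unfolding s_def using k wk by (intro mswap_WC) auto
    have fixed: "s (w i) = i" if "i < N" "w i = i" for i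
    proof -
      have "i \<noteq> k" "i \<noteq> w k" "i \<noteq> mir k" "i \<noteq> mir (w k)"
        using that k wk less.prems WC_inj[OF less.prems] WC_mir[OF less.prems] by auto
      then show ?thesis
        using that by (simp add: s_def mswap_def)
    qed
    have "{i. i < N \<and> (s \<circ> w) i \<noteq> i} \<subset> {i. i < N \<and> w i \<noteq> i}"
    proof
      show "{i. i < N \<and> (s \<circ> w) i \<noteq> i} \<subseteq> {i. i < N \<and> w i \<noteq> i}"
        using fixed by auto
      have "(s \<circ> w) k = k"
        by (simp add: s_def mswap_def)
      then show "{i. i < N \<and> (s \<circ> w) i \<noteq> i} \<noteq> {i. i < N \<and> w i \<noteq> i}"
        using k by blast
    qed
    then have "reps n (s \<circ> w) \<noteq> {}"
      using s less.prems by (intro less.hyps psubset_card_mono WC_comp) auto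
    \<comment> \<open>The parameters are \<open>p = 1\<close>, with \<open>q = 1 / 4\<close> for a
      long root and \<open>q = 1\<close> otherwise.\<close>
    moreover have "1 * (if w k = mir k then 1 / 4 else 1) * (if w k = mir k then 4 else 1) = (1 :: complex)"
      by simp
    then have "reps n s \<noteq> {}"
      using rmat_reps[OF k(1) wk(1,2)] unfolding s_def by blast
    ultimately obtain d e where "d \<in> reps n s" "e \<in> reps n (s \<circ> w)"
      by blast
    then have "mmul N d e \<in> reps n (s \<circ> (s \<circ> w))"
      using s less.prems by (intro reps_mmul WC_comp)
    moreover have "s \<circ> (s \<circ> w) = w"
      using mswap_mswap[OF k(1) wk(1,2)] by (auto simp: s_def)
    ultimately show ?thesis
      by auto
  qed
qed

lemma reps_ginv_nonzero:
  assumes "d \<in> reps n u" "u \<in> WC n" "i < N" "j < N"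
  shows "ginv d i j \<noteq> 0 \<longleftrightarrow> j = u i"
proof -
  have "ginv d i j \<noteq> 0 \<longleftrightarrow> mir j = u (mir i)"
    using assms reps_nonzero[OF assms(1), of "mir j" "mir i"] by (simp add: ginv_def)
  then show ?thesis
    using assms by (simp add: WC_mir)
qed

lemma conj_reps:
  assumes d: "d \<in> reps n u" and u: "u \<in> WC n" and ij: "i < N" "j < N"
  shows "conj d y i j = ginv d i (u i) * y (u i) (u j) * d (u j) j"
proof -
  have "(\<Sum>m<N. ginv d i m * y m (u j)) = (\<Sum>m<N. if m = u i then ginv d i (u i) * y (u i) (u j) else 0)"
    using reps_ginv_nonzero[OF d u ij(1)] by (intro sum.cong) auto
  then have "mmul N (ginv d) y i (u j) = ginv d i (u i) * y (u i) (u j)"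
    using u ij by (simp add: mmul_def)
  then show ?thesis
    using ij by (simp add: conj_def mmul_reps_right[OF d u])
qed

lemma reps_cancel:
  assumes d: "d \<in> reps n u" and u: "u \<in> WC n" and i: "i < N"
  shows "ginv d i (u i) * d (u i) i = 1"
proof -
  have "mmul N (ginv d) d i i = 1"
    using i GC_ginv_left[OF reps_GC[OF d]] by (simp add: idm_def)
  then show ?thesis
    using i by (simp add: mmul_reps_right[OF d u])
qed

text \<open>Conjugation by a monomial matrix relabels positions by \<open>u\<close>, so root lines
  go to root lines; the scalar \<open>c\<close> depends on the chosen representative.\<close>

lemma conj_reps_evec:
  assumes d: "d \<in> reps n u" and u: "u \<in> WC n" and ij: "i < N" "j < N" "i \<noteq> j"
  obtains c where "c \<noteq> 0" "conj d (evec (u i) (u j)) = msmult c (evec i j)"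
proof -
  let ?y = "conj d (evec (u i) (u j))"
  have "?y = msmult (?y i j / (if j = mir i then 2 else 1)) (evec i j)"
  proof (rule supported_on_root)
    show "?y \<in> gC n"
      using ij u by (intro conj_gC reps_GC[OF d]) simp
    fix k l assume nz: "?y k l \<noteq> 0"
    then have kl: "k < N" "l < N"
      by (auto simp: conj_def mmul_def split: if_splits)
    then have "evec (u i) (u j) (u k) (u l) \<noteq> 0"
      using nz by (auto simp: conj_reps[OF d u])
    then have "(u k = u i \<and> u l = u j) \<or> (u k = mir (u j) \<and> u l = mir (u i))"
      by (auto simp: evec_def split: if_splits)
    then show "(k = i \<and> l = j) \<or> (k = mir j \<and> l = mir i)"
      using ij by (simp add: WC_mir[OF u, symmetric] WC_inj[OF u])
  qed (use ij in auto)
  moreover have "evec (u i) (u j) (u i) (u j) \<noteq> 0"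
    using ij u by (auto simp: evec_eq)
  then have "?y i j \<noteq> 0"
    using reps_cancel[OF d u ij(1)] reps_cancel[OF d u ij(2)] ij by (auto simp: conj_reps[OF d u])
  ultimately show ?thesis
    by (intro that[of "?y i j / (if j = mir i then 2 else 1)"]) auto
qed

subsection \<open>Schubert varieties\<close>

lemma openin_flag_top:
  "openin (flag_top n) S \<longleftrightarrow>
    S \<subseteq> flagC n \<and> openin (top_of_set (GC n)) {g \<in> GC n. lcoset n g \<in> S}"
proof -
  have "istopology (\<lambda>S. S \<subseteq> flagC n \<and> openin (top_of_set (GC n)) {g \<in> GC n. lcoset n g \<in> S})"
    unfolding istopology_def
  proof (intro conjI allI impI)
    fix S T
    assume "S \<subseteq> flagC n \<and> openin (top_of_set (GC n)) {g \<in> GC n. lcoset n g \<in> S}"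
      and "T \<subseteq> flagC n \<and> openin (top_of_set (GC n)) {g \<in> GC n. lcoset n g \<in> T}"
    moreover have "{g \<in> GC n. lcoset n g \<in> S \<inter> T}
        = {g \<in> GC n. lcoset n g \<in> S} \<inter> {g \<in> GC n. lcoset n g \<in> T}"
      by blast
    ultimately show "S \<inter> T \<subseteq> flagC n"
      and "openin (top_of_set (GC n)) {g \<in> GC n. lcoset n g \<in> S \<inter> T}"
      by auto
  next
    fix K
    assume *: "\<forall>S\<in>K. S \<subseteq> flagC n \<and> openin (top_of_set (GC n)) {g \<in> GC n. lcoset n g \<in> S}"
    then show "\<Union>K \<subseteq> flagC n"
      by blast
    have "{g \<in> GC n. lcoset n g \<in> \<Union>K} = \<Union>((\<lambda>S. {g \<in> GC n. lcoset n g \<in> S}) ` K)"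
      by blast
    then show "openin (top_of_set (GC n)) {g \<in> GC n. lcoset n g \<in> \<Union>K}"
      using * by (auto intro!: openin_Union)
  qed
  then show ?thesis
    unfolding flag_top_def by simp
qed

lemma topspace_flag_top: "topspace (flag_top n) = flagC n"
proof
  show "topspace (flag_top n) \<subseteq> flagC n"
    using openin_topspace[of "flag_top n"] unfolding openin_flag_top by (rule conjunct1)
  have "{g \<in> GC n. lcoset n g \<in> flagC n} = GC n"
    by (auto simp: flagC_def)
  then have "openin (flag_top n) (flagC n)"
    by (simp add: openin_flag_top)
  then show "flagC n \<subseteq> topspace (flag_top n)"
    by (rule openin_subset)
qed

text \<open>An open set around the coset of \<open>g 0\<close> pulls back along the curve to a
  neighbourhood of 0, which contains a nonzero parameter.\<close>

lemma curve_limit_mem_closure: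
  fixes g :: "complex \<Rightarrow> cmat"
  assumes "\<And>q. g q \<in> GC n" "continuous_on UNIV g" "\<And>q. q \<noteq> 0 \<Longrightarrow> lcoset n (g q) \<in> C"
  shows "lcoset n (g 0) \<in> flag_top n closure_of C"
proof -
  have "\<exists>y. y \<in> C \<and> y \<in> T" if T: "lcoset n (g 0) \<in> T" "openin (flag_top n) T" for T
  proof -
    obtain U where U: "open U" "{h \<in> GC n. lcoset n h \<in> T} = GC n \<inter> U"
      using T(2) by (auto simp: openin_flag_top openin_open)
    have "open (g -` U)"
      using open_vimage[OF U(1) assms(2)] .
    moreover have "0 \<in> g -` U"
      using T(1) U(2) assms(1)[of 0] by blast
    ultimately obtain e where e: "e > 0" "ball 0 e \<subseteq> g -` U"
      using open_contains_ball by blast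
    define q where "q = complex_of_real (e / 2)"
    have "q \<in> ball 0 e" "q \<noteq> 0"
      using e(1) by (auto simp: q_def norm_mult)
    then have "g q \<in> {h \<in> GC n. lcoset n h \<in> T}"
      using e(2) assms(1) by (auto simp: U(2))
    then show ?thesis
      using assms(3)[OF \<open>q \<noteq> 0\<close>] by blast
  qed
  moreover have "lcoset n (g 0) \<in> flagC n"
    using assms(1) by (simp add: flagC_def)
  ultimately show ?thesis
    by (simp add: in_closure_of topspace_flag_top)
qed

lemma reps_ginv:
  assumes d: "d \<in> reps n u" and u: "u \<in> WC n"
  shows "ginv d \<in> reps n (inv u)"
proof -
  have "j = u i \<longleftrightarrow> i = inv u j" for i j
    using permutes_inverses[OF WC_permutes[OF u]] by metis
  then show ?thesis
    using reps_ginv_nonzero[OF d u] GC_ginv[OF reps_GC[OF d]] by (simp add: reps_def)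
qed

text \<open>Conjugation by \<open>ginv d\<close> is \<open>d y d^-1\<close>; it carries the root
  subgroup at \<open>(i, j)\<close> to that at \<open>(u i, u j)\<close>, which is positive because
  \<open>u i < u j\<close>.\<close>

lemma reps_unip_upper:
  assumes d: "d \<in> reps n u" and u: "u \<in> WC n" and ij: "i < N" "j < N" "i \<noteq> j" "u i < u j"
  shows "conj (ginv d) (unip i j p) \<in> BC n"
proof -
  let ?y = "conj (ginv d) (unip i j p)"
  have "?y \<in> GC n"
    unfolding conj_def using ij by (intro GC_mmul GC_ginv reps_GC[OF d] unip_GC)
  moreover have "?y k l = 0" if "l < k" for k l
  proof (rule ccontr)
    assume nz: "?y k l \<noteq> 0"
    then have kl: "k < N" "l < N"
      by (auto simp: conj_def mmul_def split: if_splits)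
    define a b where "a = inv u k" and "b = inv u l"
    have ab: "k = u a" "l = u b" "a < N" "b < N"
      using permutes_inverses[OF WC_permutes[OF u]] WC_inv[OF u] kl by (auto simp: a_def b_def)
    have "unip i j p a b \<noteq> 0"
      using nz kl by (auto simp: conj_reps[OF reps_ginv[OF d u] WC_inv[OF u]] a_def b_def)
    then have "a = b \<or> (a = i \<and> b = j) \<or> (a = mir j \<and> b = mir i)"
      by (auto simp: unip_def madd_def msmult_def idm_def evec_def split: if_splits)
    then have "u a \<le> u b"
      using ij u by (auto simp: WC_mir)
    then show False
      using ab that by simp
  qed
  ultimately show ?thesis
    by (simp add: BC_iff upper_def)
qed

lemma continuous_on_mmul_unip: "continuous_on UNIV (\<lambda>q. mmul N A (unip i j q))"
proof (intro continuous_on_coordinatewise_then_product)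
  fix k l
  show "continuous_on UNIV (\<lambda>q. mmul N A (unip i j q) k l)"
    by (cases "k < N \<and> l < N")
       (auto simp: mmul_def unip_def madd_def msmult_def intro!: continuous_intros)
qed

text \<open>In the rank one subgroup of a root, the element \<^term>\<open>unip j i q\<close> with
  \<^term>\<open>q \<noteq> 0\<close> lies in the big cell and tends to the identity as \<^term>\<open>q\<close> tends to 0.\<close>

lemma schubert_cell_subset_ascent:
  assumes u: "u \<in> WC n" and ij: "i < j" "j < N" "u i < u j"
  shows "schubert_cell n u \<subseteq> schubert_C n (u \<circ> mswap i j)"
proof
  fix X assume "X \<in> schubert_cell n u"
  then obtain b d where bd: "b \<in> BC n" "d \<in> reps n u" and X: "X = lcoset n (mmul N b d)"
    by (auto simp: schubert_cell_def)
  note dG = reps_GC[OF bd(2)] and bG = BC_GC[OF bd(1)]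
  define g where "g q = mmul N (mmul N b d) (unip j i q)" for q
  have "lcoset n (g 0) \<in> flag_top n closure_of (schubert_cell n (u \<circ> mswap i j))"
  proof (rule curve_limit_mem_closure)
    show "g q \<in> GC n" for q
      unfolding g_def using ij by (intro GC_mmul unip_GC bG dG) auto
    show "continuous_on UNIV g"
      unfolding g_def by (rule continuous_on_mmul_unip)
  next
    fix q :: complex assume q: "q \<noteq> 0"
    \<comment> \<open>This \<open>p\<close> makes \<open>rmat i j p q\<close> monomial. Solving its
      definition for the middle factor writes \<open>unip j i q\<close> as
      \<open>unip i j p\<close>, \<open>rmat i j p q\<close>, \<open>unip i j p\<close> in this
      order.\<close>
    define p where "p = 1 / (q * (if j = mir i then 4 else 1))"
    have pq: "p * q * (if j = mir i then 4 else 1) = 1"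
      using q by (simp add: p_def)
    let ?r = "rmat i j p q" and ?e = "unip i j p"
    have e: "?e \<in> GC n" "is_mat N ?e" "?e = ginv (unip i j (- p))"
      using ij by (auto simp: unip_GC ginv_unip)
    have eG: "unip i j (- p) \<in> GC n"
      using ij by (simp add: unip_GC)
    have "mmul N ?e (mmul N ?r ?e) = unip j i q"
      using ij mmul_cancel_left(2)[OF eG] GC_ginv_right[OF eG] unfolding e(3) rmat_def
      by (simp add: mmul_assoc)
    then have "g q = mmul N (mmul N b d) (mmul N ?e (mmul N ?r ?e))"
      by (simp add: g_def)
    \<comment> \<open>The left factor \<open>?e\<close> moves past \<open>d\<close> and is absorbed
      into the Borel element; the right one lies in \<open>BC n\<close> and does not change the
      coset.\<close>
    also have "\<dots> = mmul N (mmul N (mmul N b (conj (ginv d) ?e)) (mmul N d ?r)) ?e"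
      using dG e by (simp add: conj_def mmul_assoc mmul_cancel_left)
    finally have gq: "g q = mmul N (mmul N (mmul N b (conj (ginv d) ?e)) (mmul N d ?r)) ?e" .
    have dr: "mmul N d ?r \<in> reps n (u \<circ> mswap i j)"
      using bd(2) ij pq by (intro reps_mmul rmat_reps mswap_WC) auto
    have b': "mmul N b (conj (ginv d) ?e) \<in> BC n"
      using ij by (intro BC_mmul reps_unip_upper[OF bd(2) u] bd) auto
    have "lcoset n (g q) = lcoset n (mmul N (mmul N b (conj (ginv d) ?e)) (mmul N d ?r))"
      unfolding gq using b' dr ij by (intro lcoset_mmul_BC GC_mmul BC_GC reps_GC unip_BC)
    then show "lcoset n (g q) \<in> schubert_cell n (u \<circ> mswap i j)"
      using b' dr by (auto simp: schubert_cell_def)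
  qed
  moreover have "g 0 = mmul N b d"
    by (simp add: g_def)
  ultimately show "X \<in> schubert_C n (u \<circ> mswap i j)"
    by (simp add: X schubert_C_def)
qed

section \<open>Closure relations and the rank obstruction\<close>

lemma schubert_C_mono:
  "schubert_cell n u \<subseteq> schubert_C n v \<Longrightarrow> schubert_C n u \<subseteq> schubert_C n v"
  unfolding schubert_C_def by (rule closure_of_minimal) auto

lemma schubert_cell_subset: "schubert_cell n u \<subseteq> schubert_C n u"
  unfolding schubert_C_def
proof (rule closure_of_subset)
  show "schubert_cell n u \<subseteq> topspace (flag_top n)"
    by (auto simp: schubert_cell_def topspace_flag_top flagC_def GC_mmul BC_GC reps_GC)
qed

lemma continuous_on_minor:
  "continuous_on UNIV (\<lambda>g. mdet k (\<lambda>a b. mmul N g B (f a) (h b)))"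
proof -
  have "continuous_on UNIV (\<lambda>g. mmul N g B i j)" for i j
  proof (cases "i < N \<and> j < N")
    case True
    have "continuous_on UNIV (\<lambda>g :: cmat. g i k)" for k
      by (intro continuous_on_product_then_coordinatewise[of _ "\<lambda>g. g i"] continuous_on_product_coordinates)
    then show ?thesis
      using True by (auto simp: mmul_def intro!: continuous_intros)
  qed (auto simp: mmul_def)
  then show ?thesis
    unfolding mdet_def by (intro continuous_intros)
qed

text \<open>On the cell of \<open>v\<close>, the submatrix with rows from \<open>q\<close> on and
  columns up to \<open>p\<close> has rank at most the count for \<open>v\<close>, so a minor of the
  larger size counted for \<open>u\<close> vanishes. At \<open>d\<close> that minor is nonzero, and
  its nonvanishing is an open condition.\<close>

lemma not_mem_schubert_C:
  assumes u: "u \<in> WC n" and v: "v \<in> WC n" and p: "p < N"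
    and card: "card {i. i \<le> p \<and> q \<le> v i} < card {i. i \<le> p \<and> q \<le> u i}"
    and d: "d \<in> reps n u"
  shows "lcoset n d \<notin> schubert_C n v"
proof
  assume mem: "lcoset n d \<in> schubert_C n v"
  define C where "C = {i. i \<le> p \<and> q \<le> u i}"
  define M where "M = {i. i \<le> p \<and> q \<le> v i}"
  obtain f where f: "bij_betw f {..<card C} C"
    using ex_bij_betw_nat_finite[of C] by (auto simp: C_def atLeast0LessThan)
  have fC: "f a \<le> p" "q \<le> u (f a)" "f a < N" if "a < card C" for a
    using that p bij_betwE[OF f] le_less_trans[of "f a" p N] by (auto simp: C_def)
  define m where "m g = mdet (card C) (\<lambda>a b. g (u (f a)) (f b))" for g :: cmat
  have m_cell: "m (mmul N (mmul N b e) b') = 0" if b: "b \<in> BC n" "b' \<in> BC n" and e: "e \<in> reps n v" for b b' e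
  proof -
    have "mmul N (mmul N b e) b' (u (f a)) (f c)
        = (\<Sum>k\<in>M. (b (u (f a)) (v k) * e (v k) k) * b' k (f c))" if "a < card C" "c < card C" for a c
    proof -
      note fa = fC[OF that(1)] and fc = fC[OF that(2)]
      have "mmul N (mmul N b e) b' (u (f a)) (f c)
          = (\<Sum>k<N. (b (u (f a)) (v k) * e (v k) k) * b' k (f c))"
        using fa fc u by (simp add: mmul_def[of N _ b'] mmul_reps_right[OF e v])
      also have "\<dots> = (\<Sum>k\<in>M. (b (u (f a)) (v k) * e (v k) k) * b' k (f c))"
      proof (rule sum.mono_neutral_right)
        show "M \<subseteq> {..<N}"
          using p by (auto simp: M_def)
        show "\<forall>k\<in>{..<N} - M. b (u (f a)) (v k) * e (v k) k * b' k (f c) = 0"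
        proof
          fix k assume "k \<in> {..<N} - M"
          then have "p < k \<or> v k < q"
            by (auto simp: M_def)
          \<comment> \<open>Either \<open>b'\<close> or \<open>b\<close> then has an entry below its
            diagonal as a factor, so only indices in \<open>M\<close> contribute.\<close>
          then have "f c < k \<or> v k < u (f a)"
            using fa fc by auto
          then show "b (u (f a)) (v k) * e (v k) k * b' k (f c) = 0"
            using BC_entry_zero[OF b(1), of "v k" "u (f a)"] BC_entry_zero[OF b(2), of "f c" k] by auto
        qed
      qed simp
      finally show ?thesis .
    qed
    then have "m (mmul N (mmul N b e) b')
        = mdet (card C) (\<lambda>a c. \<Sum>k\<in>M. (b (u (f a)) (v k) * e (v k) k) * b' k (f c))"
      unfolding m_def by (intro mdet_cong)
    also have "\<dots> = 0"
      using card by (intro mdet_low_rank) (auto simp: M_def C_def)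
    finally show ?thesis .
  qed
  have md: "m d \<noteq> 0"
  proof -
    have off: "d (u (f a)) (f c) = 0 \<longleftrightarrow> a \<noteq> c" if "a < card C" "c < card C" for a c
    proof -
      have "f a = f c \<longleftrightarrow> a = c"
        using f that by (auto simp: bij_betw_def inj_on_def)
      then show ?thesis
        using reps_nonzero[OF d, of "u (f a)" "f c"] fC that u WC_inj[OF u] by auto
    qed
    have "m d = (\<Prod>a<card C. d (u (f a)) (f a))"
      unfolding m_def using off by (intro mdet_upper) auto
    then show ?thesis
      using off by auto
  qed
  \<comment> \<open>The minor is a function on the group, not on cosets; allowing any right
    translate by \<open>BC n\<close> makes the condition well defined on cosets and keeps it
    open.\<close>
  define T where "T = {lcoset n g | g. g \<in> GC n \<and> (\<exists>b\<in>BC n. m (mmul N g b) \<noteq> 0)}"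
  have T: "lcoset n g \<in> T \<longleftrightarrow> (\<exists>b\<in>BC n. m (mmul N g b) \<noteq> 0)" if g: "g \<in> GC n" for g
  proof
    assume "lcoset n g \<in> T"
    then obtain g' b where g': "lcoset n g = lcoset n g'" "g' \<in> GC n" "b \<in> BC n" "m (mmul N g' b) \<noteq> 0"
      by (auto simp: T_def)
    obtain b0 where "b0 \<in> BC n" "g' = mmul N g b0"
      using lcoset_eq_D[OF g'(1,2)] by blast
    then show "\<exists>b\<in>BC n. m (mmul N g b) \<noteq> 0"
      using g' BC_mmul[of b0 b] by (auto simp: mmul_assoc)
  qed (use g in \<open>auto simp: T_def\<close>)
  have "openin (flag_top n) T"
    unfolding openin_flag_top
  proof
    show "T \<subseteq> flagC n"
      by (auto simp: T_def flagC_def)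
    have "{g \<in> GC n. lcoset n g \<in> T} = GC n \<inter> (\<Union>b\<in>BC n. {g. m (mmul N g b) \<noteq> 0})"
      using T by auto
    moreover have "open {g. m (mmul N g b) \<noteq> 0}" for b
      unfolding m_def by (intro open_Collect_neq continuous_on_minor continuous_on_const)
    ultimately show "openin (top_of_set (GC n)) {g \<in> GC n. lcoset n g \<in> T}"
      by (simp add: openin_open_Int open_UN)
  qed
  moreover have "lcoset n d \<in> T"
    using md d by (auto simp: T[OF reps_GC[OF d]] reps_GC intro!: bexI[of _ "idm N"])
  ultimately obtain X where "X \<in> schubert_cell n v" "X \<in> T"
    using mem by (auto simp: schubert_C_def in_closure_of)
  then obtain b e where be: "b \<in> BC n" "e \<in> reps n v" "lcoset n (mmul N b e) \<in> T"
    by (auto simp: schubert_cell_def)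
  moreover have "mmul N b e \<in> GC n"
    using be by (intro GC_mmul BC_GC reps_GC)
  ultimately show False
    using T m_cell by blast
qed

subsection \<open>Subspaces stable under the Borel subgroup\<close>

text \<open>Conjugation by \<open>unip i j s\<close> is the polynomial
  \<open>y - s [e, y] - s^2 e y e\<close> in \<open>s\<close>, with \<open>e\<close> the root
  vector. The difference of its values at -1 and 1 leaves only the linear term, so no limit is
  taken.\<close>

lemma bracket_eq_conj_diff:
  assumes "i < N" "j < N" "i \<noteq> j" "is_mat N y"
  shows "bracket N (evec i j) y
    = msmult (1 / 2) (madd (conj (unip i j (-1)) y) (msmult (-1) (conj (unip i j 1) y)))"
  using assms unfolding conj_def ginv_unip[OF assms(1,2)] unfolding unip_def
  by (simp add: mmul_madd_left mmul_madd_right mmul_msmult_left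
      mmul_msmult_right) (simp add: bracket_def madd_def msmult_def msub_def fun_eq_iff field_simps)

lemma BC_stable_raising:
  assumes "subsp K" "\<And>b y. b \<in> BC n \<Longrightarrow> y \<in> K \<Longrightarrow> conj b y \<in> K"
  shows "raising K"
  unfolding raising_def
proof (intro conjI allI impI ballI)
  fix i j y assume "i < j" "j < N" "y \<in> K"
  then show "bracket N (evec i j) y \<in> K"
    using subspD(1)[OF assms(1), of y]
    by (simp add: bracket_eq_conj_diff subspD(3,4)[OF assms(1)] assms(2) unip_BC)
qed (rule assms(1))

text \<open>The one-parameter torus for coordinate \<open>a\<close>, evaluated at 2. This single
  element separates weights because distinct integer powers of 2 differ.\<close>

definition torus :: "nat \<Rightarrow> cmat" where
  "torus a = (\<lambda>i j. if i = j \<and> i < N then 2 powi wt a i else 0)"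

lemma wt_mir: "a < N \<Longrightarrow> i < N \<Longrightarrow> wt a (mir i) = - wt a i"
  by (auto simp: wt_def)

lemma ginv_torus:
  assumes "a < N"
  shows "ginv (torus a) = (\<lambda>i j. if i = j \<and> i < N then 2 powi (- wt a i) else 0)"
  using assms by (auto simp: fun_eq_iff ginv_def torus_def wt_mir)

lemma mmul_diagonal_left:
  assumes "i < N" "j < N"
  shows "mmul N (\<lambda>i j. if i = j \<and> i < N then f i else 0) A i j = f i * A i j"
proof -
  have "(\<Sum>k<N. (if i = k \<and> i < N then f i else 0) * A k j) = (\<Sum>k<N. if k = i then f i * A i j else 0)"
    using assms by (intro sum.cong) auto
  then show ?thesis
    using assms by (simp add: mmul_def)
qed

lemma mmul_diagonal_right:
  assumes "i < N" "j < N"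
  shows "mmul N A (\<lambda>i j. if i = j \<and> i < N then f i else 0) i j = A i j * f j"
proof -
  have "(\<Sum>k<N. A i k * (if k = j \<and> k < N then f k else 0)) = (\<Sum>k<N. if k = j then A i j * f j else 0)"
    using assms by (intro sum.cong) auto
  then show ?thesis
    using assms by (simp add: mmul_def)
qed

lemma torus_BC:
  assumes a: "a < N"
  shows "torus a \<in> BC n"
proof -
  have "(\<Prod>i<N. torus a i i) = (\<Prod>i\<in>{a, mir a}. torus a i i)"
    using a by (intro prod.mono_neutral_right) (auto simp: torus_def wt_def)
  also have "\<dots> = 1"
    using a by (simp add: torus_def wt_def)
  finally have "mdet N (torus a) = 1"
    by (subst mdet_upper) (auto simp: torus_def)
  moreover have "mmul N (torus a) (ginv (torus a)) = idm N"
  proof (rule cmat_eqI)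
    fix i j assume ij: "i < N" "j < N"
    show "mmul N (torus a) (ginv (torus a)) i j = idm N i j"
      using ij unfolding ginv_torus[OF a] unfolding torus_def mmul_diagonal_left[OF ij]
      by (auto simp: idm_def power_int_minus)
  qed (auto simp: mmul_def idm_def)
  moreover have "mmul N (ginv (torus a)) (torus a) = idm N"
  proof (rule cmat_eqI)
    fix i j assume ij: "i < N" "j < N"
    show "mmul N (ginv (torus a)) (torus a) i j = idm N i j"
      using ij unfolding ginv_torus[OF a] unfolding torus_def mmul_diagonal_left[OF ij]
      by (auto simp: idm_def power_int_minus)
  qed (auto simp: mmul_def idm_def)
  ultimately show ?thesis
    by (auto simp: BC_iff GC_iff is_mat_def upper_def torus_def)
qed

lemma conj_torus:
  assumes a: "a < N" and y: "is_mat N y"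
  shows "conj (torus a) y = (\<lambda>i j. 2 powi (wt a j - wt a i) * y i j)"
proof (rule cmat_eqI)
  fix i j assume ij: "i < N" "j < N"
  show "conj (torus a) y i j = 2 powi (wt a j - wt a i) * y i j"
    unfolding conj_def ginv_torus[OF a] unfolding torus_def
      mmul_diagonal_right[OF ij] mmul_diagonal_left[OF ij]
    by (simp add: power_int_diff power_int_minus field_simps)
qed (use y in \<open>auto simp: conj_def mmul_def is_mat_def\<close>)

lemma two_powi_inject: "(2 :: complex) powi k = 2 powi l \<longleftrightarrow> k = l"
proof
  assume "(2 :: complex) powi k = 2 powi l"
  then have "norm ((2 :: complex) powi k) = norm ((2 :: complex) powi l)"
    by simp
  then have "(2 :: real) powi k = 2 powi l"
    by (simp add: norm_power_int)
  then show "k = l"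
    using power_int_strict_increasing[of k l "2 :: real"] power_int_strict_increasing[of l k "2 :: real"]
    by (cases k l rule: linorder_cases) auto
qed simp

lemma BC_stable_weight_closed:
  assumes K: "subsp K" "\<And>b y. b \<in> BC n \<Longrightarrow> y \<in> K \<Longrightarrow> conj b y \<in> K"
  shows "weight_closed K"
  unfolding weight_closed_def
proof (intro allI impI ballI)
  fix a m y assume a: "a < N" and y: "y \<in> K"
  have "(\<lambda>i j. 2 powi (wt a j - wt a i) * z i j) \<in> K" if "z \<in> K" for z
    using K(2)[OF torus_BC[OF a] that] subspD(1)[OF K(1) that] by (simp add: conj_torus a)
  from eigencomponent_mem[OF K(1) this y, of "2 powi (- m)"]
  have "(\<lambda>i j. if wt a j - wt a i = - m then y i j else 0) \<in> K"
    by (simp only: two_powi_inject)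
  moreover have "wt a j - wt a i = - m \<longleftrightarrow> wt a i - wt a j = m" for i j
    by auto
  ultimately show "(\<lambda>i j. if wt a i - wt a j = m then y i j else 0) \<in> K"
    by simp
qed

subsection \<open>Combinatorics of the pattern\<close>

text \<open>Here \<open>m1\<close> to \<open>m4\<close> stand for the mirror images of
  \<open>p1\<close> to \<open>p4\<close>. Passing from \<open>v\<close> to \<open>u\<close> lowers
  values only at \<open>p3\<close>, \<open>m2\<close> and raises them only at \<open>p2\<close>,
  \<open>m3\<close>. An offending row index \<open>p3\<close> or \<open>m2\<close> is moved to
  \<open>p4\<close> or \<open>m1\<close>, an offending column index \<open>p2\<close> or
  \<open>m3\<close> to \<open>p1\<close> or \<open>m4\<close>.\<close>

lemma exchange_pairs:
  fixes u v :: "nat \<Rightarrow> nat"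
  assumes p: "p1 < p2" "p2 < p3" "p3 < p4" and m: "m4 < m3" "m3 < m2" "m2 < m1"
    and vp: "v p4 < v p2" "v p2 < v p3" "v p3 < v p1"
    and vm: "v m1 < v m3" "v m3 < v m2" "v m2 < v m4"
    and up: "u p2 = v p3" "u p3 = v p2" and um: "u m2 = v m3" "u m3 = v m2"
    and eq: "\<And>k. k \<notin> {p2, p3, m2, m3} \<Longrightarrow> u k = v k"
    and neq: "p1 \<noteq> m1" "p4 \<noteq> m4" "i \<noteq> j"
    and less: "i < M" "p4 < M" "m1 < M"
  shows "\<exists>i' j'. i \<le> i' \<and> j' \<le> j \<and> i' \<noteq> j' \<and> i' < M \<and> v i' \<le> u i \<and> u j \<le> v j'"
proof -
  have A: "v k \<le> u k" if "k \<noteq> p3" "k \<noteq> m2" for k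
    using that eq[of k] up um vp vm by (cases "k \<in> {p2, p3, m2, m3}") auto
  have B: "u k \<le> v k" if "k \<noteq> p2" "k \<noteq> m3" for k
    using that eq[of k] up um vp vm by (cases "k \<in> {p2, p3, m2, m3}") auto
  consider (0) "i \<noteq> p3" "i \<noteq> m2" "j \<noteq> p2" "j \<noteq> m3"
    | (1) "i = p3" "j = p2" | (2) "i = p3" "j = m3"
    | (3) "i = p3" "j = p4" "j \<noteq> p2" "j \<noteq> m3" | (4) "i = p3" "j \<noteq> p4" "j \<noteq> p2" "j \<noteq> m3"
    | (5) "i = m2" "j = p2" | (6) "i = m2" "j = m3"
    | (7) "i = m2" "j = m1" "j \<noteq> p2" "j \<noteq> m3" | (8) "i = m2" "j \<noteq> m1" "j \<noteq> p2" "j \<noteq> m3"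
    | (9) "j = p2" "i = p1" "i \<noteq> p3" "i \<noteq> m2" | (10) "j = p2" "i \<noteq> p1" "i \<noteq> p3" "i \<noteq> m2"
    | (11) "j = m3" "i = m4" "i \<noteq> p3" "i \<noteq> m2" | (12) "j = m3" "i \<noteq> m4" "i \<noteq> p3" "i \<noteq> m2"
    by blast
  then show ?thesis
  proof cases
    case 0
    then show ?thesis using A[of i] B[of j] neq less by blast
  next
    case 1
    then show ?thesis using p vp up less by (intro exI[of _ p4] exI[of _ p1]) auto
  next
    case 2
    then show ?thesis using p m vp vm up um neq less by (intro exI[of _ p4] exI[of _ m4]) auto
  next
    case 3
    \<comment> \<open>Moving only the row would make both indices \<open>p4\<close>, so the column
      steps back to \<open>p3\<close>. The cases 7, 9 and 11 avoid a coincidence in the same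
      way.\<close>
    then show ?thesis using p vp up B[of j] less by (intro exI[of _ p4] exI[of _ p3]) auto
  next
    case 4
    then show ?thesis using p vp up B[of j] less by (intro exI[of _ p4] exI[of _ j]) auto
  next
    case 5
    then show ?thesis using p m vp vm up um neq less by (intro exI[of _ m1] exI[of _ p1]) auto
  next
    case 6
    then show ?thesis using m vm um less by (intro exI[of _ m1] exI[of _ m4]) auto
  next
    case 7
    then show ?thesis using m vm um B[of j] less by (intro exI[of _ m1] exI[of _ m2]) auto
  next
    case 8
    then show ?thesis using m vm um B[of j] less by (intro exI[of _ m1] exI[of _ j]) auto
  next
    case 9
    then show ?thesis using p vp up A[of i] less by (intro exI[of _ p2] exI[of _ p1]) auto
  next
    case 10
    then show ?thesis using p vp up A[of i] less by (intro exI[of _ i] exI[of _ p1]) auto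
  next
    case 11
    then show ?thesis using m vm um A[of i] less by (intro exI[of _ m3] exI[of _ m4]) auto
  next
    case 12
    then show ?thesis using m vm um A[of i] less by (intro exI[of _ i] exI[of _ m4]) auto
  qed
qed

text \<open>The count gains \<open>p2\<close>; \<open>p3\<close> lies outside the range. Only
  \<open>m2\<close> can be lost, and then \<open>m3\<close> is gained as well. The condition on
  \<open>m3 = p2\<close> covers the case where \<open>p2\<close> and \<open>p3\<close> are mirror
  images, when \<open>m3\<close> would be no new gain.\<close>

lemma exchange_card:
  fixes u v :: "nat \<Rightarrow> nat"
  assumes p: "p2 < p3" and m: "m3 < m2" "m3 = p2 \<Longrightarrow> m2 = p3"
    and v: "v p2 < v p3" "v m3 < v m2"
    and up: "u p2 = v p3" "u p3 = v p2" and um: "u m2 = v m3" "u m3 = v m2"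
    and eq: "\<And>k. k \<notin> {p2, p3, m2, m3} \<Longrightarrow> u k = v k"
  shows "card {i. i \<le> p2 \<and> v p3 \<le> v i} < card {i. i \<le> p2 \<and> v p3 \<le> u i}"
proof -
  define A where "A = {i. i \<le> p2 \<and> v p3 \<le> v i}"
  define B where "B = {i. i \<le> p2 \<and> v p3 \<le> u i}"
  have fin: "finite A" "finite B"
    by (auto simp: A_def B_def)
  have p2: "p2 \<in> B" "p2 \<notin> A"
    using up v by (auto simp: A_def B_def)
  have sub: "k \<in> B" if "k \<in> A" "k \<noteq> m2" for k
    using that eq[of k] up um v p by (cases "k \<in> {p2, p3, m2, m3}") (auto simp: A_def B_def)
  have "card A < card B"
  proof (cases "m2 \<in> A \<and> m2 \<notin> B")
    case False
    then have "A \<subset> B"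
      using sub p2 by blast
    then show ?thesis
      using fin by (intro psubset_card_mono)
  next
    \<comment> \<open>Two gains, \<open>p2\<close> and \<open>m3\<close>, outweigh the single loss
      \<open>m2\<close>.\<close>
    case True
    then have m3: "m3 \<notin> A" "m3 \<in> B" "m3 \<noteq> p2"
      using um m p by (auto simp: A_def B_def)
    have "card A = Suc (card (A - {m2}))"
      using True fin by (intro card_Suc_Diff1[symmetric]) auto
    also have "\<dots> < Suc (Suc (card (A - {m2})))"
      by simp
    also have "\<dots> = card (insert p2 (insert m3 (A - {m2})))"
      using fin p2 m3 by simp
    also have "\<dots> \<le> card B"
      using fin p2 m3 sub by (intro card_mono) auto
    finally show ?thesis .
  qed
  then show ?thesis
    by (simp add: A_def B_def)
qed

section \<open>Relations among coroots\<close>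

lemma evec_mir_diagonal: "i < N \<Longrightarrow> evec (mir i) (mir i) = msmult (-1) (evec i i)"
  using evec_mir[of i i] by simp

lemma fdiff_sym:
  assumes "subsp S" "fdiff i j \<in> S"
  shows "fdiff j i \<in> S"
proof -
  have "fdiff j i = msmult (-1) (fdiff i j)"
    by (simp add: fdiff_def madd_def msmult_def)
  then show ?thesis
    using subspD(4)[OF assms] by simp
qed

lemma fdiff_trans:
  assumes "subsp S" "fdiff i j \<in> S" "fdiff j k \<in> S"
  shows "fdiff i k \<in> S"
proof -
  have "fdiff i k = madd (fdiff i j) (fdiff j k)"
    by (simp add: fdiff_def madd_def msmult_def)
  then show ?thesis
    using subspD(3)[OF assms] by simp
qed

lemma fdiff_mir:
  assumes "i < N" "j < N"
  shows "fdiff (mir i) (mir j) = fdiff j i"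
  using assms by (simp add: fdiff_def evec_mir_diagonal) (simp add: madd_def msmult_def)

lemma fdiff_self_mir:
  assumes "subsp S" "i < N"
  shows "fdiff i (mir i) \<in> S \<longleftrightarrow> evec i i \<in> S"
proof -
  have "fdiff i (mir i) = msmult 2 (evec i i)"
    using assms(2) by (simp add: fdiff_def evec_mir_diagonal) (simp add: madd_def msmult_def)
  then show ?thesis
    using subspD(4)[OF assms(1)] subsp_msmult_cancel[OF assms(1), of 2 "evec i i"] by auto
qed

lemma fdiff_mem_iff:
  assumes "subsp S" "evec i i \<in> S"
  shows "fdiff i j \<in> S \<longleftrightarrow> evec j j \<in> S"
proof
  assume "evec j j \<in> S"
  then show "fdiff i j \<in> S"
    unfolding fdiff_def using assms by (intro subspD(3,4)[OF assms(1)])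
next
  assume *: "fdiff i j \<in> S"
  have "evec j j = madd (evec i i) (msmult (-1) (fdiff i j))"
    by (simp add: fdiff_def madd_def msmult_def)
  then show "evec j j \<in> S"
    using subspD(3,4)[OF assms(1)] assms(2) * by metis
qed

text \<open>The set \<^term>\<open>U\<close> stands for the Weyl group elements below a given one, and \<^term>\<open>t\<close>
  for a diagonal matrix whose conjugates by \<^term>\<open>U\<close> lie in the subspace \<^term>\<open>S\<close>.\<close>

definition descent_closed :: "cmat set \<Rightarrow> (nat \<Rightarrow> complex) \<Rightarrow> (nat \<Rightarrow> nat) set \<Rightarrow> bool" where
  "descent_closed S t U \<longleftrightarrow> subsp S \<and> U \<subseteq> WC n \<and> (\<forall>k<N. t (mir k) = - t k)
    \<and> (\<forall>u\<in>U. \<forall>i j. i < j \<longrightarrow> j < N \<longrightarrow> u j < u i \<longrightarrow>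
        u \<circ> mswap i j \<in> U \<and> (t (u i) \<noteq> t (u j) \<longrightarrow> fdiff i j \<in> S))"

lemma descent_closedD:
  assumes "descent_closed S t U"
  shows "subsp S" "u \<in> U \<Longrightarrow> u \<in> WC n" "k < N \<Longrightarrow> t (mir k) = - t k"
    "u \<in> U \<Longrightarrow> i < j \<Longrightarrow> j < N \<Longrightarrow> u j < u i \<Longrightarrow> u \<circ> mswap i j \<in> U"
    "u \<in> U \<Longrightarrow> i < j \<Longrightarrow> j < N \<Longrightarrow> u j < u i \<Longrightarrow> t (u i) \<noteq> t (u j) \<Longrightarrow> fdiff i j \<in> S"
  using assms by (auto simp: descent_closed_def)

definition pat :: "(nat \<Rightarrow> nat) \<Rightarrow> nat \<Rightarrow> nat \<Rightarrow> nat \<Rightarrow> nat \<Rightarrow> bool" where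
  "pat v p1 p2 p3 p4 \<longleftrightarrow> p1 < p2 \<and> p2 < p3 \<and> p3 < p4 \<and> p4 < N
    \<and> v p4 < v p2 \<and> v p2 < v p3 \<and> v p3 < v p1"

text \<open>The pattern 4231 is invariant under reversing both positions and values.\<close>

lemma pat_mir:
  assumes "v \<in> WC n" "pat v p1 p2 p3 p4"
  shows "pat v (mir p4) (mir p3) (mir p2) (mir p1)"
  using assms by (simp add: pat_def WC_mir)

text \<open>With \<open>t\<close> equal at \<open>p1\<close>, \<open>p2\<close>, \<open>p4\<close>,
  the inversions of \<open>v\<close> among the four positions link \<open>p3\<close> to
  \<open>p1\<close> and to \<open>p4\<close> but never reach \<open>p2\<close>. The missing link
  comes from a smaller element of \<open>U\<close> or from inversions involving mirror
  positions.\<close>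

lemma fdiff_pattern_special:
  assumes D: "descent_closed S t U" and v: "v \<in> U" and pat: "pat v p1 p2 p3 p4"
    and eq: "t (v p1) = t (v p2)" "t (v p4) = t (v p2)" "t (v p2) \<noteq> t (v p3)"
  shows "fdiff p2 p3 \<in> S"
proof -
  note S = descent_closedD(1)[OF D] and mem = descent_closedD(5)[OF D v]
  have vW: "v \<in> WC n"
    by (rule descent_closedD(2)[OF D v])
  have p: "p1 < p2" "p2 < p3" "p3 < p4" "p4 < N" "v p4 < v p2" "v p2 < v p3" "v p3 < v p1"
    "p1 < N" "p2 < N" "p3 < N"
    using pat by (auto simp: pat_def)
  have tm: "t (v (mir k)) = - t (v k)" if "k < N" for k
    using descent_closedD(3)[OF D, of "v k"] that vW by (simp add: WC_mir)
  have f13: "fdiff p1 p3 \<in> S" and f34: "fdiff p3 p4 \<in> S"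
    using p eq by (auto intro!: mem)
  consider "p2 \<noteq> mir p1" "p2 \<noteq> mir p3" | "p2 = mir p3" | "p2 = mir p1"
    by blast
  then show ?thesis
  proof cases
    case 1
    \<comment> \<open>Exchanging the values at \<open>p1\<close> and \<open>p3\<close> keeps
      \<open>p1\<close>, \<open>p2\<close> an inversion and puts the distinguished value of
      \<open>t\<close> at \<open>p1\<close>. This needs \<open>p2\<close> to be unmoved, hence the
      two other cases.\<close>
    let ?u = "v \<circ> mswap p1 p3"
    have "?u \<in> U"
      using p by (intro descent_closedD(4)[OF D v]) auto
    moreover have "?u p1 = v p3" "?u p2 = v p2"
      using p 1 by (auto simp: mswap_def)
    ultimately have "fdiff p1 p2 \<in> S"
      using p eq by (intro descent_closedD(5)[OF D, of ?u]) auto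
    then show ?thesis
      using fdiff_trans[OF S fdiff_sym[OF S] f13] by blast
  next
    case 2
    \<comment> \<open>Since \<open>t\<close> differs at \<open>p2\<close> and \<open>p3\<close>, it
      is nonzero there and at \<open>p1\<close>. The inversion of \<open>p1\<close> with its own
      mirror then yields \<open>evec p1 p1\<close>, from which the long coroot at \<open>p3\<close>
      follows.\<close>
    have "t (v p3) = - t (v p2)"
      using tm[of p3] 2 p by simp
    then have "t (v p1) \<noteq> t (v (mir p1))"
      using eq tm[of p1] p by auto
    moreover have "p1 < mir p1" "v (mir p1) < v p1"
    proof -
      have "mir p3 < mir p1" "mir (v p1) < mir (v p3)"
        using p vW by simp_all
      then show "p1 < mir p1"
        using p 2 by linarith
      have "mir (v p3) = v p2"
        using 2 p vW by (simp add: WC_mir)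
      then show "v (mir p1) < v p1"
        using \<open>mir (v p1) < mir (v p3)\<close> p vW by (simp add: WC_mir)
    qed
    ultimately have "fdiff p1 (mir p1) \<in> S"
      using p by (intro mem) auto
    then have "evec p1 p1 \<in> S"
      using fdiff_self_mir[OF S] p by blast
    then have "evec p3 p3 \<in> S"
      using fdiff_mem_iff[OF S] f13 by blast
    then have "fdiff p3 (mir p3) \<in> S"
      using fdiff_self_mir[OF S] p by blast
    then show ?thesis
      using fdiff_sym[OF S] 2 by simp
  next
    case 3
    \<comment> \<open>Now \<open>t\<close> vanishes at \<open>p1\<close>, \<open>p2\<close> and
      \<open>p4\<close> but not at \<open>p3\<close>, so the inversion of \<open>mir p4\<close> with
      \<open>p3\<close> is available and leads to \<open>evec p3 p3\<close>.\<close>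
    have t0: "t (v p2) = 0"
      using tm[of p1] 3 p eq by simp
    have "mir p4 < p3" "v p3 < v (mir p4)"
    proof -
      have "mir p4 < mir p2" "mir (v p2) < mir (v p4)"
        using p vW by simp_all
      moreover have "mir p2 = p1" "mir (v p2) = v p1"
        using p vW 3 by (simp_all add: WC_mir)
      ultimately show "mir p4 < p3" "v p3 < v (mir p4)"
        using p vW by (auto simp: WC_mir)
    qed
    moreover have "t (v (mir p4)) \<noteq> t (v p3)"
      using tm[of p4] eq t0 p by simp
    ultimately have "fdiff (mir p4) p3 \<in> S"
      using p by (intro mem) auto
    then have "fdiff (mir p3) p4 \<in> S"
      using fdiff_mir[of "mir p4" p3] fdiff_mir[of p4 "mir p3"] p by simp
    then have "fdiff p3 (mir p3) \<in> S"
      using fdiff_trans[OF S f34] fdiff_sym[OF S] by blast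
    then have "evec p3 p3 \<in> S"
      using fdiff_self_mir[OF S] p by blast
    then have "evec p1 p1 \<in> S" "evec p3 p3 \<in> S"
      using fdiff_mem_iff[OF S] fdiff_sym[OF S f13] by blast+
    then have "evec p2 p2 \<in> S"
      using subspD(4)[OF S, of "evec p1 p1" "-1"] 3 p by (simp add: evec_mir_diagonal)
    then show ?thesis
      using fdiff_mem_iff[OF S] \<open>evec p3 p3 \<in> S\<close> by blast
  qed
qed

text \<open>The five inversions of the pattern give links between positions with different
  \<open>t\<close>. If \<open>p1\<close> or \<open>p4\<close> differs from both middle positions, it
  connects them; if they match different middle positions, the link from \<open>p1\<close> to
  \<open>p4\<close> does. If they match the same one, the special case or its mirror image
  applies.\<close>

lemma fdiff_pattern:
  assumes D: "descent_closed S t U" and v: "v \<in> U" and pat: "pat v p1 p2 p3 p4"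
    and ne: "t (v p2) \<noteq> t (v p3)"
  shows "fdiff p2 p3 \<in> S"
proof -
  note S = descent_closedD(1)[OF D] and mem = descent_closedD(5)[OF D v]
  note sym = fdiff_sym[OF S] and trans = fdiff_trans[OF S]
  have vW: "v \<in> WC n"
    by (rule descent_closedD(2)[OF D v])
  have p: "p1 < p2" "p2 < p3" "p3 < p4" "p4 < N" "v p4 < v p2" "v p2 < v p3" "v p3 < v p1"
    "p1 < N" "p2 < N" "p3 < N"
    using pat by (auto simp: pat_def)
  have f: "t (v p1) \<noteq> t (v p2) \<Longrightarrow> fdiff p1 p2 \<in> S" "t (v p1) \<noteq> t (v p3) \<Longrightarrow> fdiff p1 p3 \<in> S"
    "t (v p1) \<noteq> t (v p4) \<Longrightarrow> fdiff p1 p4 \<in> S" "t (v p2) \<noteq> t (v p4) \<Longrightarrow> fdiff p2 p4 \<in> S"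
    "t (v p3) \<noteq> t (v p4) \<Longrightarrow> fdiff p3 p4 \<in> S"
    using p by (auto intro!: mem)
  consider (1) "t (v p1) \<noteq> t (v p2)" "t (v p1) \<noteq> t (v p3)"
    | (2) "t (v p4) \<noteq> t (v p2)" "t (v p4) \<noteq> t (v p3)"
    | (3) "t (v p1) = t (v p2)" "t (v p4) = t (v p3)" | (4) "t (v p1) = t (v p3)" "t (v p4) = t (v p2)"
    | (5) "t (v p1) = t (v p2)" "t (v p4) = t (v p2)" | (6) "t (v p1) = t (v p3)" "t (v p4) = t (v p3)"
    by blast
  then show ?thesis
  proof cases
    case 1
    then show ?thesis using trans[OF sym[OF f(1)] f(2)] by simp
  next
    case 2
    then show ?thesis using trans[OF f(4) sym[OF f(5)]] by auto
  next
    case 3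
    then show ?thesis
      using trans[OF trans[OF f(4) sym[OF f(3)]] f(2)] ne by auto
  next
    case 4
    then show ?thesis
      using trans[OF trans[OF sym[OF f(1)] f(3)] sym[OF f(5)]] ne by auto
  next
    case 5
    then show ?thesis
      using fdiff_pattern_special[OF D v pat] ne by blast
  next
    case 6
    have tm: "t (v (mir k)) = - t (v k)" if "k < N" for k
      using descent_closedD(3)[OF D, of "v k"] that vW by (simp add: WC_mir)
    have "fdiff (mir p3) (mir p2) \<in> S"
      using fdiff_pattern_special[OF D v pat_mir[OF vW pat]] 6 ne p by (simp add: tm)
    then show ?thesis
      using p by (simp add: fdiff_mir)
  qed
qed

subsection \<open>Hessenberg varieties that are Schubert varieties\<close>

definition diagm :: "(nat \<Rightarrow> complex) \<Rightarrow> cmat" where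
  "diagm t = (\<lambda>k l. if k = l \<and> k < N then t k else 0)"

text \<open>A reflection changes a diagonal element by the value of the root times the coroot; the
  division by 2 accounts for the doubled \<open>fdiff\<close> of a long root.\<close>

lemma diagm_diff:
  assumes t: "\<And>k. k < N \<Longrightarrow> t (mir k) = - t k" and u: "u \<in> WC n" and ij: "i < N" "j < N" "i \<noteq> j"
  shows "diagm (t \<circ> u) = madd (diagm (t \<circ> (u \<circ> mswap i j)))
    (msmult ((t (u i) - t (u j)) / (if j = mir i then 2 else 1)) (fdiff i j))"
proof (rule cmat_eqI)
  fix k l assume kl: "k < N" "l < N"
  have tu: "t (u (mir k)) = - t (u k)" if "k < N" for k
    using that u t[of "u k"] by (simp add: WC_mir)
  have e: "t (u k) = t (u (mswap i j k))
      + (t (u i) - t (u j)) / (if j = mir i then 2 else 1) * fdiff i j k k"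
  proof (cases "j = mir i")
    case True
    have "fdiff i j k k = 2 * ((if k = i then 1 else 0) - (if k = mir i then 1 else 0))"
      using ij True by (simp add: fdiff_def madd_def msmult_def evec_def)
    then show ?thesis
      using True ij tu[of i] by (simp add: mswap_def)
  next
    case False
    obtain i' j' where m: "mir i = i'" "mir j = j'"
      by blast
    have d: "i \<noteq> i'" "j \<noteq> j'" "i \<noteq> j'" "j \<noteq> i'" "i' \<noteq> j'"
      using ij False by (auto simp: m[symmetric])
    have t': "t (u i') = - t (u i)" "t (u j') = - t (u j)"
      using tu[of i] tu[of j] ij by (simp_all add: m)
    have f: "fdiff i j k k = ((if k = i then 1 else 0) - (if k = i' then 1 else 0))
        - ((if k = j then 1 else 0) - (if k = j' then 1 else 0))"
      by (simp add: fdiff_def madd_def msmult_def evec_def m)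
    consider (1) "k = i" | (2) "k = j" | (3) "k = i'" | (4) "k = j'"
      | (5) "k \<noteq> i" "k \<noteq> j" "k \<noteq> i'" "k \<noteq> j'"
      by blast
    then show ?thesis
    proof cases
      case 1
      show ?thesis unfolding mswap_def f m unfolding 1 using d t' ij(3) by simp
    next
      case 2
      show ?thesis unfolding mswap_def f m unfolding 2 using d t' ij(3) by simp
    next
      case 3
      show ?thesis unfolding mswap_def f m unfolding 3 using d t' ij(3) by simp
    next
      case 4
      show ?thesis unfolding mswap_def f m unfolding 4 using d t' ij(3) by simp
    next
      case 5
      then show ?thesis unfolding mswap_def f m by simp
    qed
  qed
  show "diagm (t \<circ> u) k l = madd (diagm (t \<circ> (u \<circ> mswap i j)))
    (msmult ((t (u i) - t (u j)) / (if j = mir i then 2 else 1)) (fdiff i j)) k l"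
  proof (cases "k = l")
    case True
    then show ?thesis
      using kl e by (simp add: diagm_def madd_def msmult_def)
  next
    case False
    then have "fdiff i j k l = 0"
      by (auto simp: fdiff_def madd_def msmult_def evec_def)
    then show ?thesis
      using False by (simp add: diagm_def madd_def msmult_def)
  qed
qed (use ij in \<open>auto simp: diagm_def madd_def msmult_def fdiff_def evec_outside\<close>)

lemma conj_reps_dg:
  assumes "d \<in> reps n u" "u \<in> WC n"
  shows "conj d (dg y) = diagm ((\<lambda>k. y k k) \<circ> u)"
proof (rule cmat_eqI)
  fix i j assume ij: "i < N" "j < N"
  then show "conj d (dg y) i j = diagm ((\<lambda>k. y k k) \<circ> u) i j"
    using reps_cancel[OF assms ij(1)] WC_inj[OF assms(2), of i j]
    by (auto simp: conj_reps[OF assms] dg_def diagm_def mult.commute)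
qed (auto simp: conj_def mmul_def diagm_def)

text \<open>The lower Bruhat interval, encoded by closures so that no combinatorial description of
  the order is required.\<close>

definition below :: "(nat \<Rightarrow> nat) \<Rightarrow> (nat \<Rightarrow> nat) set" where
  "below v = {u \<in> WC n. schubert_cell n u \<subseteq> schubert_C n v}"

lemma below_mswap:
  assumes u: "u \<in> below v" and ij: "i < j" "j < N" "u j < u i"
  shows "u \<circ> mswap i j \<in> below v"
proof -
  let ?s = "mswap i j"
  have uW: "u \<in> WC n" and sub: "schubert_cell n u \<subseteq> schubert_C n v"
    using u by (auto simp: below_def)
  have us: "u \<circ> ?s \<in> WC n"
    using ij by (intro WC_comp uW mswap_WC) auto
  have "(u \<circ> ?s) i < (u \<circ> ?s) j"
    using ij by (simp add: mswap_def)
  from schubert_cell_subset_ascent[OF us ij(1,2) this]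
  have "schubert_cell n (u \<circ> ?s) \<subseteq> schubert_C n (u \<circ> ?s \<circ> ?s)" .
  also have "u \<circ> ?s \<circ> ?s = u"
    using mswap_mswap[of i j] ij by (auto simp: fun_eq_iff)
  also have "schubert_C n u \<subseteq> schubert_C n v"
    using sub by (rule schubert_C_mono)
  finally show ?thesis
    using us unfolding below_def by blast
qed

lemma no_pattern:
  assumes v: "v \<in> WC n" and x: "x \<in> gC n" and H: "hessenberg_C n H"
    and eq: "hess_var n x H = schubert_C n v"
  shows "\<not> pat v p1 p2 p3 p4"
proof
  assume pat: "pat v p1 p2 p3 p4"
  then have p: "p1 < p2" "p2 < p3" "p3 < p4" "p4 < N" "v p4 < v p2" "v p2 < v p3" "v p3 < v p1"
    "p1 < N" "p2 < N" "p3 < N"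
    by (auto simp: pat_def)
  note HS = hessenberg_subsp[OF H] and HR = hessenberg_raising[OF H]
  have vb: "v \<in> below v"
    using v by (simp add: below_def schubert_cell_subset)
  \<comment> \<open>Instead of the span of the Borel orbit of \<open>x\<close>, this takes every
    \<open>y\<close> that satisfies the condition at all points of all cells below \<open>v\<close>.
    It contains \<open>x\<close>, and linearity and stability under \<open>BC n\<close> are
    immediate.\<close>
  define K where "K = {y \<in> gC n. \<forall>u\<in>below v. \<forall>d\<in>reps n u. \<forall>b\<in>BC n. conj (mmul N b d) y \<in> H}"
  have K: "subsp K"
    unfolding subsp_def K_def
    by (auto simp: zmat_gC conj_zmat conj_madd conj_msmult gC_madd gC_msmult subspD[OF HS])
  have KB: "conj b y \<in> K" if b: "b \<in> BC n" and y: "y \<in> K" for b y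
    unfolding K_def
  proof (intro CollectI conjI ballI)
    show "conj b y \<in> gC n"
      using b y by (auto simp: K_def intro!: conj_gC BC_GC)
    fix u d b' assume "u \<in> below v" "d \<in> reps n u" "b' \<in> BC n"
    then have "conj (mmul N (mmul N b b') d) y \<in> H"
      using y BC_mmul[OF b] by (auto simp: K_def)
    then show "conj (mmul N b' d) (conj b y) \<in> H"
      by (simp add: conj_mmul)
  qed
  note KR = BC_stable_raising[OF K KB] and KW = BC_stable_weight_closed[OF K KB]
  have KH: "conj d y \<in> H" if "y \<in> K" "u \<in> below v" "d \<in> reps n u" for y u d
  proof -
    have "conj (mmul N (idm N) d) y \<in> H"
      using that by (auto simp: K_def)
    then show ?thesis
      using reps_GC[OF that(3)] by simp
  qed
  have xK: "x \<in> K"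
    unfolding K_def
  proof (intro CollectI conjI ballI)
    fix u d b assume ud: "u \<in> below v" "d \<in> reps n u" "b \<in> BC n"
    then have "lcoset n (mmul N b d) \<in> hess_var n x H"
      unfolding eq by (auto simp: below_def schubert_cell_def)
    moreover have "mmul N b d \<in> GC n"
      using ud by (intro GC_mmul BC_GC reps_GC)
    ultimately show "conj (mmul N b d) x \<in> H"
      using hess_var_iff[OF H] by blast
  qed (rule x)
  define u where "u = v \<circ> mswap p2 p3"
  have uW: "u \<in> WC n"
    unfolding u_def using p by (intro WC_comp v mswap_WC) auto
  obtain du dv where du: "du \<in> reps n u" and dv: "dv \<in> reps n v"
    using reps_nonempty[OF uW] reps_nonempty[OF v] by blast
  have diag: "conj du (dg x) \<in> H"
  proof -
    define t where "t = (\<lambda>k. x k k)"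
    have t: "t (mir k) = - t k" if "k < N" for k
      using gC_entry[OF x that that] by (simp add: t_def)
    have DH: "diagm (t \<circ> u) \<in> H" if "u \<in> below v" for u
    proof -
      have "u \<in> WC n"
        using that by (simp add: below_def)
      moreover from this obtain d where "d \<in> reps n u"
        using reps_nonempty by blast
      ultimately show ?thesis
        using KH[OF diagonal_component_mem[OF K KW xK] that] by (simp add: conj_reps_dg t_def)
    qed
    have "descent_closed H t (below v)"
      unfolding descent_closed_def
    proof (intro conjI allI ballI impI)
      fix u i j assume u: "u \<in> below v" and ij: "i < j" "j < N" "u j < u i"
      then show us: "u \<circ> mswap i j \<in> below v"
        by (rule below_mswap)
      assume ne: "t (u i) \<noteq> t (u j)"
      \<comment> \<open>Both fixed points lie in the Schubert variety, so both diagonal conjugates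
        are in \<open>H\<close>; their difference is a nonzero multiple of the coroot.\<close>
      have "madd (diagm (t \<circ> u)) (msmult (-1) (diagm (t \<circ> (u \<circ> mswap i j)))) \<in> H"
        using DH[OF u] DH[OF us] by (intro subspD(3,4)[OF HS])
      also have "diagm (t \<circ> u) = madd (diagm (t \<circ> (u \<circ> mswap i j)))
          (msmult ((t (u i) - t (u j)) / (if j = mir i then 2 else 1)) (fdiff i j))"
        using u ij by (intro diagm_diff t) (auto simp: below_def)
      also have "madd (madd A B) (msmult (-1) A) = B" for A B
        by (simp add: madd_def msmult_def)
      finally show "fdiff i j \<in> H"
        by (rule subsp_msmult_cancel[OF HS]) (use ne in auto)
    qed (use HS t in \<open>auto simp: below_def\<close>)
    then have f: "t (v p2) \<noteq> t (v p3) \<Longrightarrow> fdiff p2 p3 \<in> H"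
      using fdiff_pattern[OF _ vb pat] by blast
    let ?c = "(t (u p2) - t (u p3)) / (if p3 = mir p2 then 2 else 1)"
    have "?c = 0 \<or> fdiff p2 p3 \<in> H"
      using f p by (cases "t (v p2) = t (v p3)") (auto simp: u_def mswap_def)
    then have "msmult ?c (fdiff p2 p3) \<in> H"
    proof
      assume "?c = 0"
      then have "msmult ?c (fdiff p2 p3) = zmat"
        by (simp only: msmult_def zmat_def mult_zero_left)
      then show ?thesis
        using subspD(2)[OF HS] by simp
    qed (rule subspD(4)[OF HS])
    moreover have "u \<circ> mswap p2 p3 = v"
      using mswap_mswap[of p2 p3] p by (auto simp: u_def fun_eq_iff)
    moreover have "diagm (t \<circ> u) = madd (diagm (t \<circ> (u \<circ> mswap p2 p3))) (msmult ?c (fdiff p2 p3))"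
      using p by (intro diagm_diff t uW) auto
    ultimately have "diagm (t \<circ> u) \<in> H"
      using subspD(3)[OF HS DH[OF vb]] by metis
    then show ?thesis
      by (simp add: conj_reps_dg[OF du uW] t_def)
  qed
  have m: "mir p4 < mir p3" "mir p3 < mir p2" "mir p2 < mir p1"
    "v (mir p1) < v (mir p3)" "v (mir p3) < v (mir p2)" "v (mir p2) < v (mir p4)"
    using pat_mir[OF v pat] by (auto simp: pat_def)
  have us: "u p2 = v p3" "u p3 = v p2" "u (mir p2) = v (mir p3)" "u (mir p3) = v (mir p2)"
    "\<And>k. k \<notin> {p2, p3, mir p2, mir p3} \<Longrightarrow> u k = v k"
    using p by (auto simp: u_def mswap_def)
  have off: "conj du (evec a b) \<in> H"
    if ab: "a < N" "b < N" "a \<noteq> b" and e: "evec a b \<in> K" for a b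
  proof -
    define i j where "i = inv u a" and "j = inv u b"
    have ij: "a = u i" "b = u j" "i < N" "j < N" "i \<noteq> j"
      using permutes_inverses[OF WC_permutes[OF uW]] WC_inv[OF uW] ab by (auto simp: i_def j_def WC_inj[OF WC_inv[OF uW]])
    have "\<exists>i' j'. i \<le> i' \<and> j' \<le> j \<and> i' \<noteq> j' \<and> i' < N \<and> v i' \<le> u i \<and> u j \<le> v j'"
      by (rule exchange_pairs[OF p(1-3) m(1-3) p(5-7) m(4-6) us]) (use p ij in auto)
    then obtain i' j' where ij': "i \<le> i'" "j' \<le> j" "i' \<noteq> j'" "i' < N" "v i' \<le> u i" "u j \<le> v j'"
      by blast
    \<comment> \<open>Raising is used twice: in \<open>K\<close>, from \<open>(u i, u j)\<close> to
      \<open>(v i', v j')\<close>, and after conjugation by \<open>dv\<close> in \<open>H\<close>,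
      from \<open>(i', j')\<close> to \<open>(i, j)\<close>.\<close>
    have "evec (v i') (v j') \<in> K"
      by (rule raise[OF KR e]) (use ij ij' ab v WC_inj[OF v] in auto)
    then have "conj dv (evec (v i') (v j')) \<in> H"
      by (rule KH[OF _ vb dv])
    moreover obtain c where c: "c \<noteq> 0" "conj dv (evec (v i') (v j')) = msmult c (evec i' j')"
      using conj_reps_evec[OF dv v, of i' j'] ij' ij by auto
    ultimately have "evec i' j' \<in> H"
      using subsp_msmult_cancel[OF HS] by auto
    then have "evec i j \<in> H"
      by (rule raise[OF HR]) (use ij ij' in auto)
    then show ?thesis
      using conj_reps_evec[OF du uW ij(3-5)] subspD(4)[OF HS] by (metis ij(1,2))
  qed
  have "x \<in> {y \<in> gC n. conj du y \<in> H}"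
  proof (rule mem_subsp_of_components[OF subsp_vimage_conj[OF HS reps_GC[OF du]] x])
    show "dg x \<in> {y \<in> gC n. conj du y \<in> H}"
      using diag subspD(1)[OF K diagonal_component_mem[OF K KW xK]] by simp
    show "evec a b \<in> {y \<in> gC n. conj du y \<in> H}"
      if "a < N" "b < N" "a \<noteq> b" "x a b \<noteq> 0" for a b
      using that off[OF that(1-3) root_component_mem[OF K KW xK that]] by simp
  qed
  then have "lcoset n du \<in> schubert_C n v"
    using hess_var_iff[OF H reps_GC[OF du]] by (simp add: eq[symmetric])
  \<comment> \<open>The separating minor takes the columns up to \<open>p2\<close> and the rows from
    \<open>v p3\<close> on, where \<open>u\<close> has the larger count.\<close>
  moreover have "card {i. i \<le> p2 \<and> v p3 \<le> v i} < card {i. i \<le> p2 \<and> v p3 \<le> u i}"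
    by (rule exchange_card[OF p(2) m(2) _ p(6) m(5) us]) (use p in auto)
  then have "lcoset n du \<notin> schubert_C n v"
    using not_mem_schubert_C[OF uW v p(9) _ du] by blast
  ultimately show False
    by simp
qed

end

theorem theorem1p11:
  fixes n :: nat and w :: "nat \<Rightarrow> nat"
  assumes "w \<in> WC n"
    and "\<exists>x H. x \<in> gC n \<and> hessenberg_C n H \<and> hess_var n x H = schubert_C n (inv w)"
  shows "avoids (2*n) w [3, 1, 2, 0]"
  unfolding avoids_def
proof
  interpret symplectic n .
  have len: "length [3, 1, 2, 0::nat] = 4"
    by simp
  assume "contains_pattern (2*n) w [3, 1, 2, 0]"
  then obtain f where f: "strict_mono_on {..<4} f" "\<forall>a<4. f a < N"
    "\<forall>a<4. \<forall>b<4. w (f a) < w (f b) \<longleftrightarrow> [3, 1, 2, 0::nat] ! a < [3, 1, 2, 0] ! b"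
    unfolding contains_pattern_def len by blast
  have f': "f 0 < f 1" "f 1 < f 2" "f 2 < f 3"
    using f(1) by (auto simp: strict_mono_on_def)
  have w: "w (f 3) < w (f 1)" "w (f 1) < w (f 2)" "w (f 2) < w (f 0)"
    using f(3)[rule_format, of 3 1] f(3)[rule_format, of 1 2] f(3)[rule_format, of 2 0]
    by (auto simp: numeral_3_eq_3 numeral_2_eq_2)
  have "inv w (w k) = k" for k
    using permutes_inverses(2)[OF WC_permutes[OF assms(1)]] .
  \<comment> \<open>Positions and values trade places under inversion: the values of
    \<open>w\<close> in increasing order become the positions, and 4231 is its own inverse.\<close>
  then have "pat (inv w) (w (f 3)) (w (f 1)) (w (f 2)) (w (f 0))"
    using f' w f(2) assms(1) by (simp add: pat_def)
  then show False
    using no_pattern[OF WC_inv[OF assms(1)]] assms(2) by blast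
qed

end
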